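(* Let $H$ be a complex Hilbert space and let $\theta\in[0,\pi/2)$. Let $(a_n)_{n\in\mathbb{N}}$ be a sequence of sectorial forms in $H$ with vertex $0$ and angle $\theta$ (not necessarily densely defined, closed or closable), and assume that for all $n\in\mathbb{N}$ one has $\operatorname{dom}(a_n)\supseteq\operatorname{dom}(a_{n+1})$ and the form $a_{n+1}-a_n$ (with domain $\operatorname{dom}(a_{n+1})$) is sectorial with vertex $0$ and angle $\theta$. For $n\in\mathbb{N}$ let $A_n$ be the m-sectorial linear relation in $H$ associated with $a_n$. Then there exists an m-sectorial linear relation $A$ in $H$ such that $A_n\to A$ as $n\to\infty$ in strong resolvent sense.
   Context: Inner products $(\cdot\mid\cdot)$ are linear in the first argument. For $0<\theta<\pi/2$ put $\Sigma_\theta:=\{z\in\mathbb{C}\setminus\{0\}: |\operatorname{Arg} z|<\theta\}$, and $\Sigma_0:=(0,\infty)$; $\overline{\Sigma_\theta}$ denotes the closure in $\mathbb{C}$. A sectorial form $a$ in $H$ with vertex $0$ and angle $\theta\in[0,\pi/2)$ is a sesquilinear map $a\colon\operatorname{dom}(a)\times\operatorname{dom}(a)\to\mathbb{C}$ (linear in the first, antilinear in the second argument), where $\operatorname{dom}(a)$ is a linear subspace of $H$ (not required to be dense), such that $a(u):=a(u,u)\in\overline{\Sigma_\theta}$ for all $u\in\operatorname{dom}(a)$. Put $\|u\|_a:=(\operatorname{Re} a(u)+\|u\|_H^2)^{1/2}$ for $u\in\operatorname{dom}(a)$. A linear relation in $H$ is a linear subspace $A$ of $H\times H$; its inverse is $A^{-1}=\{(y,x):(x,y)\in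 A\}$ and $I+A:=\{(x,x+y):(x,y)\in A\}$. $A$ is m-sectorial with vertex $0$ and angle $\theta\in[0,\pi/2)$ if $(y\mid x)\in\overline{\Sigma_\theta}$ for all $(x,y)\in A$ and $\operatorname{ran}(I+A)=\{x+y:(x,y)\in A\}=H$; in this case $(I+A)^{-1}$ is (the graph of) a bounded operator on $H$. "m-sectorial" means m-sectorial with vertex $0$ and some angle in $[0,\pi/2)$. Linear relation associated with a (not necessarily closable) sectorial form $a$: let $V$ be the completion of $(\operatorname{dom}(a),\|\cdot\|_a)$, let $j\colon V\to H$ be the continuous extension of the embedding $\operatorname{dom}(a)\hookrightarrow H$ ($j$ need not be injective), and let $\tilde a\colon V\times V\to\mathbb{C}$ be the unique continuous extension of $a$. The linear relation associated with $a$ is $$A:=\{(x,y)\in H\times H:\ \exists\,u\in V\ \text{with}\ ju=x\ \text{and}\ \tilde a(u,v)=(y\mid jv)_H\ \text{for all } v\in V\};$$ it is m-sectorial with vertex $0$ and the same angle as $a$. For m-sectorial linear relations with vertex $0$, $A_n\to A$ in strong resolvent sense means $(I+A_n)^{-1}f\to(I+A)^{-1}f$ in $H$ for all $f\in H$. *)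

theory Defs
  imports "HOL-Analysis.Analysis"
begin

section \<open>Complex Hilbert spaces\<close>

class complex_vector = ab_group_add +
  fixes scaleC :: "complex \<Rightarrow> 'a \<Rightarrow> 'a"  (infixr \<open>*\<^sub>C\<close> 75)
  assumes scaleC_add_right: "c *\<^sub>C (x + y) = c *\<^sub>C x + c *\<^sub>C y"
    and scaleC_add_left: "(c + d) *\<^sub>C x = c *\<^sub>C x + d *\<^sub>C x"
    and scaleC_scaleC: "c *\<^sub>C (d *\<^sub>C x) = (c * d) *\<^sub>C x"
    and scaleC_one: "1 *\<^sub>C x = x"

global_interpretation complex_vector: vector_space "scaleC :: complex \<Rightarrow> 'a \<Rightarrow> 'a::complex_vector"
  by standard (simp_all add: scaleC_add_right scaleC_add_left scaleC_scaleC scaleC_one)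

abbreviation csubspace :: "'a::complex_vector set \<Rightarrow> bool" where
  "csubspace \<equiv> complex_vector.subspace"

instantiation prod :: (complex_vector, complex_vector) complex_vector
begin

definition scaleC_prod :: "complex \<Rightarrow> 'a \<times> 'b \<Rightarrow> 'a \<times> 'b" where
  "scaleC_prod c p = (c *\<^sub>C fst p, c *\<^sub>C snd p)"

instance
  by standard
    (simp_all add: scaleC_prod_def prod_eq_iff scaleC_add_right scaleC_add_left scaleC_scaleC scaleC_one)

end

text \<open>The inner product is linear in its first and antilinear in its second argument.
  Completeness comes from the class \<open>banach\<close>.\<close>

class complex_hilbert_space = complex_vector + banach +
  fixes cinner :: "'a \<Rightarrow> 'a \<Rightarrow> complex"
  assumes scaleR_scaleC: "r *\<^sub>R x = complex_of_real r *\<^sub>C x"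
    and cinner_add_left: "cinner (x + y) z = cinner x z + cinner y z"
    and cinner_scaleC_left: "cinner (c *\<^sub>C x) y = c * cinner x y"
    and cinner_commute: "cinner x y = cnj (cinner y x)"
    and cinner_ge_zero: "0 \<le> Re (cinner x x)"
    and cinner_eq_zero: "cinner x x = 0 \<longleftrightarrow> x = 0"
    and norm_eq_sqrt_cinner: "norm x = sqrt (Re (cinner x x))"

instantiation complex :: complex_hilbert_space
begin

definition scaleC_complex :: "complex \<Rightarrow> complex \<Rightarrow> complex" where
  "scaleC_complex c x = c * x"

definition cinner_complex :: "complex \<Rightarrow> complex \<Rightarrow> complex" where
  "cinner_complex x y = x * cnj y"

instance
proof
  fix x :: complex
  show "norm x = sqrt (Re (cinner x x))"
    by (simp add: cinner_complex_def cmod_def power2_eq_square)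
qed (simp_all add: scaleC_complex_def cinner_complex_def algebra_simps scaleR_conv_of_real)

end


section \<open>Sectors and sectorial forms\<close>

definition sector :: "real \<Rightarrow> complex set" where
  "sector \<theta> = (if \<theta> = 0 then complex_of_real ` {0<..} else {z. z \<noteq> 0 \<and> \<bar>Arg z\<bar> < \<theta>})"

text \<open>A form is given by its domain \<open>D\<close> and a function \<open>a\<close>; the values of \<open>a\<close> outside
  \<open>D \<times> D\<close> are irrelevant.\<close>

definition sesquilinear_on ::
    "'a::complex_vector set \<Rightarrow> ('a \<Rightarrow> 'a \<Rightarrow> complex) \<Rightarrow> bool" where
  "sesquilinear_on D a \<longleftrightarrow>
     (\<forall>u\<in>D. \<forall>u'\<in>D. \<forall>v\<in>D. a (u + u') v = a u v + a u' v) \<and>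
     (\<forall>c. \<forall>u\<in>D. \<forall>v\<in>D. a (c *\<^sub>C u) v = c * a u v) \<and>
     (\<forall>u\<in>D. \<forall>v\<in>D. \<forall>v'\<in>D. a u (v + v') = a u v + a u v') \<and>
     (\<forall>c. \<forall>u\<in>D. \<forall>v\<in>D. a u (c *\<^sub>C v) = cnj c * a u v)"

definition sectorial_form ::
    "real \<Rightarrow> 'a::complex_hilbert_space set \<Rightarrow> ('a \<Rightarrow> 'a \<Rightarrow> complex) \<Rightarrow> bool" where
  "sectorial_form \<theta> D a \<longleftrightarrow>
     csubspace D \<and> sesquilinear_on D a \<and> (\<forall>u\<in>D. a u u \<in> closure (sector \<theta>))"

definition form_norm :: "('a::complex_hilbert_space \<Rightarrow> 'a \<Rightarrow> complex) \<Rightarrow> 'a \<Rightarrow> real" where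
  "form_norm a u = sqrt (Re (a u u) + (norm u)\<^sup>2)"


section \<open>Linear relations\<close>

definition linear_relation :: "('a::complex_vector \<times> 'a) set \<Rightarrow> bool" where
  "linear_relation A \<longleftrightarrow> csubspace A"

definition id_plus_rel :: "('a::complex_vector \<times> 'a) set \<Rightarrow> ('a \<times> 'a) set" where
  "id_plus_rel A = {(x, x + y) | x y. (x, y) \<in> A}"

definition m_sectorial_angle :: "real \<Rightarrow> ('a::complex_hilbert_space \<times> 'a) set \<Rightarrow> bool" where
  "m_sectorial_angle \<theta> A \<longleftrightarrow>
     linear_relation A \<and>
     (\<forall>(x, y)\<in>A. cinner y x \<in> closure (sector \<theta>)) \<and>
     Range (id_plus_rel A) = UNIV"

definition m_sectorial :: "('a::complex_hilbert_space \<times> 'a) set \<Rightarrow> bool" where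
  "m_sectorial A \<longleftrightarrow> (\<exists>\<theta>. 0 \<le> \<theta> \<and> \<theta> < pi / 2 \<and> m_sectorial_angle \<theta> A)"

text \<open>The operator whose graph is \<open>(I + A)\<^sup>-\<^sup>1\<close>; for m-sectorial \<open>A\<close> see
  \<open>m_sectorial_resolvent\<close> below.\<close>

definition resolvent :: "('a::complex_hilbert_space \<times> 'a) set \<Rightarrow> 'a \<Rightarrow> 'a" where
  "resolvent A f = (THE x. (f, x) \<in> (id_plus_rel A)\<inverse>)"

text \<open>Meant for m-sectorial relations \<open>A n\<close> and \<open>A\<close> only.\<close>

definition strong_resolvent_conv ::
    "(nat \<Rightarrow> ('a::complex_hilbert_space \<times> 'a) set) \<Rightarrow> ('a \<times> 'a) set \<Rightarrow> bool" where
  "strong_resolvent_conv A B \<longleftrightarrow> (\<forall>f. (\<lambda>n. resolvent (A n) f) \<longlonglongrightarrow> resolvent B f)"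


section \<open>The linear relation associated with a form\<close>

text \<open>The completion of \<open>D\<close> with respect to \<open>form_norm a\<close> is the set of Cauchy sequences
  modulo null sequences. The continuous extensions of the embedding and of the form are
  obtained by taking limits along representatives; see \<open>completion_map_tendsto\<close>,
  \<open>completion_form_tendsto\<close> and the corresponding lemmas about constant sequences below.\<close>

definition form_Cauchy ::
    "'a::complex_hilbert_space set \<Rightarrow> ('a \<Rightarrow> 'a \<Rightarrow> complex) \<Rightarrow> (nat \<Rightarrow> 'a) \<Rightarrow> bool" where
  "form_Cauchy D a u \<longleftrightarrow>
     (\<forall>k. u k \<in> D) \<and> (\<forall>e>0. \<exists>N. \<forall>m\<ge>N. \<forall>n\<ge>N. form_norm a (u m - u n) < e)"

definition form_equiv ::
    "'a::complex_hilbert_space set \<Rightarrow> ('a \<Rightarrow> 'a \<Rightarrow> complex) \<Rightarrow> ((nat \<Rightarrow> 'a) \<times> (nat \<Rightarrow> 'a)) set" where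
  "form_equiv D a = {(u, w). form_Cauchy D a u \<and> form_Cauchy D a w \<and>
     (\<lambda>k. form_norm a (u k - w k)) \<longlonglongrightarrow> 0}"

definition form_completion ::
    "'a::complex_hilbert_space set \<Rightarrow> ('a \<Rightarrow> 'a \<Rightarrow> complex) \<Rightarrow> (nat \<Rightarrow> 'a) set set" where
  "form_completion D a = Collect (form_Cauchy D a) // form_equiv D a"

definition completion_map :: "(nat \<Rightarrow> 'a::complex_hilbert_space) set \<Rightarrow> 'a" where
  "completion_map U = (THE x. \<forall>u\<in>U. u \<longlonglongrightarrow> x)"

definition completion_form ::
    "('a::complex_hilbert_space \<Rightarrow> 'a \<Rightarrow> complex) \<Rightarrow> (nat \<Rightarrow> 'a) set \<Rightarrow> (nat \<Rightarrow> 'a) set \<Rightarrow> complex" where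
  "completion_form a U W = (THE z. \<forall>u\<in>U. \<forall>w\<in>W. (\<lambda>k. a (u k) (w k)) \<longlonglongrightarrow> z)"

definition associated_relation ::
    "'a::complex_hilbert_space set \<Rightarrow> ('a \<Rightarrow> 'a \<Rightarrow> complex) \<Rightarrow> ('a \<times> 'a) set" where
  "associated_relation D a = {(x, y). \<exists>U\<in>form_completion D a. completion_map U = x \<and>
     (\<forall>W\<in>form_completion D a. completion_form a U W = cinner y (completion_map W))}"


section \<open>The definitions by \<open>THE\<close> and by quotients are meaningful\<close>

lemma closure_sector_bound:
  assumes "0 \<le> \<theta>" "\<theta> < pi / 2" "z \<in> closure (sector \<theta>)"
  shows "cos \<theta> * cmod z \<le> Re z"
proof -
  let ?S = "{z. cos \<theta> * cmod z \<le> Re z}"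
  have "closed ?S"
    by (intro closed_Collect_le continuous_intros)
  moreover have "sector \<theta> \<subseteq> ?S"
  proof
    fix z assume z: "z \<in> sector \<theta>"
    show "z \<in> ?S"
    proof (cases "\<theta> = 0")
      case True
      then show ?thesis using z by (auto simp: sector_def)
    next
      case False
      then have nz: "z \<noteq> 0" and Arg: "\<bar>Arg z\<bar> < \<theta>"
        using z by (auto simp: sector_def)
      have "cos \<theta> \<le> cos \<bar>Arg z\<bar>"
        using Arg assms by (intro cos_monotone_0_pi_le) auto
      moreover have "Re z = cmod z * cos (Arg z)"
        using arg_cong[OF Arg_eq[OF nz], of Re] by (simp add: Re_exp)
      ultimately show ?thesis
        by (auto simp: mult.commute intro: mult_left_mono)
    qed
  qed
  ultimately have "closure (sector \<theta>) \<subseteq> ?S"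
    by (simp add: closure_minimal)
  then show ?thesis using assms(3) by auto
qed

lemma closure_sector_Re_nonneg:
  assumes "0 \<le> \<theta>" "\<theta> < pi / 2" "z \<in> closure (sector \<theta>)"
  shows "0 \<le> Re z"
proof -
  have "0 \<le> cos \<theta> * cmod z"
    using assms by (intro mult_nonneg_nonneg cos_ge_zero) auto
  then show ?thesis using closure_sector_bound[OF assms] by linarith
qed

lemma power2_norm_eq_cinner: "(norm x)\<^sup>2 = Re (cinner x x)"
  for x :: "'a::complex_hilbert_space"
  by (simp add: norm_eq_sqrt_cinner cinner_ge_zero)

lemma cinner_parallelogram: "(norm (u + v))\<^sup>2 + (norm (u - v))\<^sup>2 = 2 * (norm u)\<^sup>2 + 2 * (norm v)\<^sup>2"
  for u v :: "'a::complex_hilbert_space"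
proof -
  have right: "cinner x (y + z) = cinner x y + cinner x z" for x y z :: 'a
    using cinner_commute[of x "y + z"] cinner_commute[of x y] cinner_commute[of x z]
    by (simp add: cinner_add_left)
  have neg: "cinner (- x) y = - cinner x y" "cinner x (- y) = - cinner x y" for x y :: 'a
  proof -
    show l: "cinner (- x) y = - cinner x y" for x y :: 'a
      using cinner_scaleC_left[of "-1" x y] by simp
    show "cinner x (- y) = - cinner x y"
      using l cinner_commute[of x "- y"] cinner_commute[of x y] by simp
  qed
  have "cinner (u - v) (u - v) = cinner (u + (- v)) (u + (- v))" by simp
  then show ?thesis
    unfolding power2_norm_eq_cinner by (simp only: cinner_add_left right neg) simp
qed

lemma m_sectorial_resolvent:
  assumes "m_sectorial A"
  shows "(f, x) \<in> (id_plus_rel A)\<inverse> \<longleftrightarrow> x = resolvent A f"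
proof -
  obtain \<theta> where \<theta>: "0 \<le> \<theta>" "\<theta> < pi / 2" and ms: "m_sectorial_angle \<theta> A"
    using assms by (auto simp: m_sectorial_def)
  have sub: "csubspace A"
    using ms by (simp add: m_sectorial_angle_def linear_relation_def)
  have ex: "\<exists>x. (f, x) \<in> (id_plus_rel A)\<inverse>" for f
    using ms by (auto simp: m_sectorial_angle_def)
  have uniq: "x = x'" if xx: "(f, x) \<in> (id_plus_rel A)\<inverse>" "(f, x') \<in> (id_plus_rel A)\<inverse>" for f x x'
  proof -
    have mem: "(z, f - z) \<in> A" if z: "(f, z) \<in> (id_plus_rel A)\<inverse>" for z
    proof -
      obtain y where "f = z + y" "(z, y) \<in> A"
        using z by (auto simp: id_plus_rel_def)
      then show ?thesis by simp
    qed
    have "(x, f - x) \<in> A" "(x', f - x') \<in> A"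
      using xx by (auto intro: mem)
    then have "(x, f - x) - (x', f - x') \<in> A"
      by (rule complex_vector.subspace_diff[OF sub])
    then have "(x - x', - (x - x')) \<in> A"
      by simp
    then have "cinner (- (x - x')) (x - x') \<in> closure (sector \<theta>)"
      using ms by (auto simp: m_sectorial_angle_def)
    then have "0 \<le> Re (cinner (- (x - x')) (x - x'))"
      by (rule closure_sector_Re_nonneg[OF \<theta>])
    moreover have "cinner (- (x - x')) (x - x') = - cinner (x - x') (x - x')"
      using cinner_scaleC_left[of "-1" "x - x'" "x - x'"] by simp
    ultimately have "(norm (x - x'))\<^sup>2 \<le> 0"
      by (simp add: power2_norm_eq_cinner)
    then show ?thesis by simp
  qed
  have "\<exists>!x. (f, x) \<in> (id_plus_rel A)\<inverse>"
    using ex[of f] uniq[of f] by (elim exE) (rule ex1I)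
  then have "(f, resolvent A f) \<in> (id_plus_rel A)\<inverse>"
    unfolding resolvent_def by (rule theI')
  then show ?thesis using uniq by blast
qed

context
  fixes \<theta> :: real and D :: "'a::complex_hilbert_space set" and a :: "'a \<Rightarrow> 'a \<Rightarrow> complex"
  assumes angle: "0 \<le> \<theta>" "\<theta> < pi / 2" and form: "sectorial_form \<theta> D a"
begin

lemma form_dom_closed:
  shows "0 \<in> D" "u \<in> D \<Longrightarrow> v \<in> D \<Longrightarrow> u + v \<in> D" "u \<in> D \<Longrightarrow> v \<in> D \<Longrightarrow> u - v \<in> D"
    "u \<in> D \<Longrightarrow> c *\<^sub>C u \<in> D" "u \<in> D \<Longrightarrow> - u \<in> D"
  using form unfolding sectorial_form_def
  by (auto intro: complex_vector.subspace_0 complex_vector.subspace_add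
      complex_vector.subspace_diff complex_vector.subspace_scale complex_vector.subspace_neg)

lemma form_add_left: "u \<in> D \<Longrightarrow> u' \<in> D \<Longrightarrow> v \<in> D \<Longrightarrow> a (u + u') v = a u v + a u' v"
  and form_scaleC_left: "u \<in> D \<Longrightarrow> v \<in> D \<Longrightarrow> a (c *\<^sub>C u) v = c * a u v"
  and form_add_right: "u \<in> D \<Longrightarrow> v \<in> D \<Longrightarrow> v' \<in> D \<Longrightarrow> a u (v + v') = a u v + a u v'"
  and form_scaleC_right: "u \<in> D \<Longrightarrow> v \<in> D \<Longrightarrow> a u (c *\<^sub>C v) = cnj c * a u v"
  using form by (auto simp: sectorial_form_def sesquilinear_on_def)

lemma form_minus_left: "u \<in> D \<Longrightarrow> v \<in> D \<Longrightarrow> a (- u) v = - a u v"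
  and form_minus_right: "u \<in> D \<Longrightarrow> v \<in> D \<Longrightarrow> a u (- v) = - a u v"
  using form_scaleC_left[of u v "-1"] form_scaleC_right[of u v "-1"] by simp_all

lemma form_diff_left: "u \<in> D \<Longrightarrow> u' \<in> D \<Longrightarrow> v \<in> D \<Longrightarrow> a (u - u') v = a u v - a u' v"
  and form_diff_right: "u \<in> D \<Longrightarrow> v \<in> D \<Longrightarrow> v' \<in> D \<Longrightarrow> a u (v - v') = a u v - a u v'"
  using form_add_left[of u "- u'" v] form_add_right[of u v "- v'"]
  by (simp_all add: form_dom_closed form_minus_left form_minus_right)

lemma form_zero_left: "v \<in> D \<Longrightarrow> a 0 v = 0"
  and form_zero_right: "u \<in> D \<Longrightarrow> a u 0 = 0"
  using form_scaleC_left[of v v 0] form_scaleC_right[of u u 0] by simp_all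

lemma form_Re_nonneg: "u \<in> D \<Longrightarrow> 0 \<le> Re (a u u)"
  using closure_sector_Re_nonneg[OF angle] form by (auto simp: sectorial_form_def)

lemma form_norm_sq: "u \<in> D \<Longrightarrow> (form_norm a u)\<^sup>2 = Re (a u u) + (norm u)\<^sup>2"
  by (simp add: form_norm_def form_Re_nonneg)

lemma form_norm_nonneg: "u \<in> D \<Longrightarrow> 0 \<le> form_norm a u"
  by (simp add: form_norm_def form_Re_nonneg)

lemma norm_le_form_norm: "u \<in> D \<Longrightarrow> norm u \<le> form_norm a u"
  unfolding form_norm_def by (rule real_le_rsqrt) (simp add: form_Re_nonneg)

lemma form_norm_zero: "form_norm a 0 = 0"
  by (simp add: form_norm_def form_zero_left form_dom_closed)

lemma form_norm_minus: "u \<in> D \<Longrightarrow> form_norm a (- u) = form_norm a u"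
  by (simp add: form_norm_def form_minus_left form_minus_right form_dom_closed)

lemma form_norm_add_sq:
  assumes "u \<in> D" "v \<in> D"
  shows "(form_norm a (u + v))\<^sup>2 \<le> 2 * (form_norm a u)\<^sup>2 + 2 * (form_norm a v)\<^sup>2"
proof -
  have "a (u + v) (u + v) + a (u - v) (u - v) = 2 * a u u + 2 * a v v"
    using assms by (simp add: form_dom_closed form_add_left form_add_right form_diff_left form_diff_right)
  then have "Re (a (u + v) (u + v)) + Re (a (u - v) (u - v)) = 2 * Re (a u u) + 2 * Re (a v v)"
    by (drule_tac arg_cong[of _ _ Re]) simp
  moreover have "0 \<le> Re (a (u - v) (u - v))"
    using assms by (simp add: form_Re_nonneg form_dom_closed)
  ultimately show ?thesis
    using cinner_parallelogram[of u v] zero_le_power2[of "norm (u - v)"]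
    unfolding form_norm_sq[OF assms(1)] form_norm_sq[OF assms(2)]
      form_norm_sq[OF form_dom_closed(2)[OF assms]]
    by argo
qed

lemma form_norm_add:
  assumes "u \<in> D" "v \<in> D"
  shows "form_norm a (u + v) \<le> 2 * (form_norm a u + form_norm a v)"
proof -
  have "0 \<le> form_norm a u * form_norm a v"
    using assms by (simp add: form_norm_nonneg)
  moreover have "(2 * (form_norm a u + form_norm a v))\<^sup>2 =
      4 * (form_norm a u)\<^sup>2 + 4 * (form_norm a v)\<^sup>2 + 8 * (form_norm a u * form_norm a v)"
    by (simp add: power2_eq_square algebra_simps)
  ultimately have "(form_norm a (u + v))\<^sup>2 \<le> (2 * (form_norm a u + form_norm a v))\<^sup>2"
    using form_norm_add_sq[OF assms] zero_le_power2[of "form_norm a u"] zero_le_power2[of "form_norm a v"]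
    by linarith
  then show ?thesis
    using assms by (elim power2_le_imp_le) (simp add: form_norm_nonneg)
qed

lemma form_bound_sum:
  assumes "u \<in> D" "v \<in> D"
  shows "cmod (a u v) \<le> ((form_norm a u)\<^sup>2 + (form_norm a v)\<^sup>2) / cos \<theta>"
proof -
  have cpos: "0 < cos \<theta>"
    using angle by (intro cos_gt_zero_pi) auto
  have diag: "cmod (a w w) \<le> Re (a w w) / cos \<theta>" if "w \<in> D" for w
    using closure_sector_bound[OF angle, of "a w w"] form that cpos
    by (simp add: sectorial_form_def pos_le_divide_eq mult.commute)
  define w where "w k = u + (\<i> ^ k) *\<^sub>C v" for k :: nat
  have wD: "w k \<in> D" for k
    using assms by (simp add: w_def form_dom_closed)
  have expand: "a (w k) (w k) = a u u + cnj (\<i> ^ k) * a u v + \<i> ^ k * a v u + \<i> ^ k * cnj (\<i> ^ k) * a v v" for k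
    using assms by (simp add: w_def form_dom_closed form_add_left form_add_right
        form_scaleC_left form_scaleC_right algebra_simps)
  have pol: "4 * a u v = a (w 0) (w 0) + \<i> * a (w 1) (w 1) - a (w 2) (w 2) - \<i> * a (w 3) (w 3)"
    by (simp add: expand power3_eq_cube algebra_simps)
  have tot: "Re (a (w 0) (w 0)) + Re (a (w 1) (w 1)) + Re (a (w 2) (w 2)) + Re (a (w 3) (w 3))
      = 4 * (Re (a u u) + Re (a v v))"
    by (simp add: expand power3_eq_cube algebra_simps)
  have "4 * cmod (a u v) = cmod (a (w 0) (w 0) + \<i> * a (w 1) (w 1) - a (w 2) (w 2) - \<i> * a (w 3) (w 3))"
    unfolding pol[symmetric] by (simp add: norm_mult)
  also have "\<dots> \<le> cmod (a (w 0) (w 0)) + cmod (a (w 1) (w 1)) + cmod (a (w 2) (w 2)) + cmod (a (w 3) (w 3))"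
    by (intro order_trans[OF norm_triangle_ineq4] order_trans[OF norm_triangle_ineq] add_mono)
      (simp_all add: norm_mult)
  also have "\<dots> \<le> Re (a (w 0) (w 0)) / cos \<theta> + Re (a (w 1) (w 1)) / cos \<theta>
      + Re (a (w 2) (w 2)) / cos \<theta> + Re (a (w 3) (w 3)) / cos \<theta>"
    by (intro add_mono diag wD)
  also have "\<dots> = 4 * ((Re (a u u) + Re (a v v)) / cos \<theta>)"
    using tot by (simp add: add_divide_distrib[symmetric])
  finally have "cmod (a u v) \<le> (Re (a u u) + Re (a v v)) / cos \<theta>"
    by linarith
  also have "\<dots> \<le> ((form_norm a u)\<^sup>2 + (form_norm a v)\<^sup>2) / cos \<theta>"
    using assms cpos by (intro divide_right_mono) (auto simp: form_norm_sq)
  finally show ?thesis .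
qed

lemma form_bound:
  assumes "u \<in> D" "v \<in> D"
  shows "cmod (a u v) \<le> 2 / cos \<theta> * form_norm a u * form_norm a v"
proof (cases "form_norm a u = 0 \<or> form_norm a v = 0")
  case True
  then have "u = 0 \<or> v = 0"
    using norm_le_form_norm assms by fastforce
  then show ?thesis
    using assms by (auto simp: form_zero_left form_zero_right form_norm_zero)
next
  case False
  then have pos: "0 < form_norm a u" "0 < form_norm a v"
    using assms form_norm_nonneg by (auto simp: order_less_le)
  define t where "t = sqrt (form_norm a v / form_norm a u)"
  have t: "0 < t" "t\<^sup>2 = form_norm a v / form_norm a u"
    using pos by (simp_all add: t_def)
  have scale: "(form_norm a (complex_of_real r *\<^sub>C w))\<^sup>2 = r\<^sup>2 * (form_norm a w)\<^sup>2" if "w \<in> D" for r w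
  proof -
    have "a (complex_of_real r *\<^sub>C w) (complex_of_real r *\<^sub>C w) = complex_of_real (r * r) * a w w"
      using that by (simp add: form_dom_closed form_scaleC_left form_scaleC_right)
    then have "Re (a (complex_of_real r *\<^sub>C w) (complex_of_real r *\<^sub>C w)) = r\<^sup>2 * Re (a w w)"
      by (simp add: power2_eq_square)
    moreover have "norm (complex_of_real r *\<^sub>C w) = \<bar>r\<bar> * norm w"
      by (metis scaleR_scaleC norm_scaleR)
    ultimately show ?thesis
      using that by (simp add: form_norm_sq form_dom_closed power_mult_distrib distrib_left)
  qed
  have "a u v = a (complex_of_real t *\<^sub>C u) (complex_of_real (1 / t) *\<^sub>C v)"
    using assms t(1) by (simp add: form_dom_closed form_scaleC_left form_scaleC_right)
  then have "cmod (a u v) \<le> (t\<^sup>2 * (form_norm a u)\<^sup>2 + (1 / t)\<^sup>2 * (form_norm a v)\<^sup>2) / cos \<theta>"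
    using form_bound_sum[of "complex_of_real t *\<^sub>C u" "complex_of_real (1 / t) *\<^sub>C v"] assms
    by (simp only: scale form_dom_closed)
  also have "t\<^sup>2 * (form_norm a u)\<^sup>2 = form_norm a u * form_norm a v"
    unfolding t(2) using pos by (simp add: power2_eq_square)
  also have "(1 / t)\<^sup>2 * (form_norm a v)\<^sup>2 = form_norm a u * form_norm a v"
    unfolding power_one_over t(2) using pos by (simp add: power2_eq_square)
  finally show ?thesis
    by (simp add: algebra_simps)
qed

lemma form_CauchyD:
  assumes "form_Cauchy D a u"
  shows "u k \<in> D" "0 < e \<Longrightarrow> \<exists>N. \<forall>m\<ge>N. \<forall>n\<ge>N. form_norm a (u m - u n) < e"
  using assms by (auto simp: form_Cauchy_def)

lemma form_Cauchy_imp_Cauchy: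
  assumes "form_Cauchy D a u"
  shows "Cauchy u"
proof (rule metric_CauchyI)
  fix e :: real assume "0 < e"
  then obtain N where "\<forall>m\<ge>N. \<forall>n\<ge>N. form_norm a (u m - u n) < e"
    using form_CauchyD(2)[OF assms] by blast
  moreover have "dist (u m) (u n) \<le> form_norm a (u m - u n)" for m n
    unfolding dist_norm by (intro norm_le_form_norm form_dom_closed form_CauchyD(1)[OF assms])
  ultimately show "\<exists>M. \<forall>m\<ge>M. \<forall>n\<ge>M. dist (u m) (u n) < e"
    by (meson le_less_trans)
qed

lemma form_Cauchy_bounded:
  assumes "form_Cauchy D a u"
  obtains B where "0 < B" "\<And>k. form_norm a (u k) \<le> B"
proof -
  have uD: "u k \<in> D" for k using form_CauchyD(1)[OF assms] .
  obtain N where N: "\<forall>m\<ge>N. \<forall>n\<ge>N. form_norm a (u m - u n) < 1"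
    using form_CauchyD(2)[OF assms, of 1] by auto
  define B where "B = 2 * (1 + form_norm a (u N)) + (\<Sum>k<N. form_norm a (u k))"
  have nn: "0 \<le> form_norm a (u k)" for k using form_norm_nonneg uD by blast
  have S: "0 \<le> (\<Sum>k<N. form_norm a (u k))" by (intro sum_nonneg nn)
  have "form_norm a (u k) \<le> B" for k
  proof (cases "k < N")
    case True
    then have "form_norm a (u k) \<le> (\<Sum>k<N. form_norm a (u k))"
      by (intro member_le_sum) (auto simp: nn)
    then show ?thesis using nn[of N] by (simp add: B_def)
  next
    case False
    have "form_norm a ((u k - u N) + u N) \<le> 2 * (form_norm a (u k - u N) + form_norm a (u N))"
      by (intro form_norm_add form_dom_closed uD)
    moreover have "form_norm a (u k - u N) < 1" using False N by simp
    ultimately show ?thesis using S by (simp add: B_def)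
  qed
  moreover have "0 < B" using S nn[of N] by (simp add: B_def)
  ultimately show ?thesis using that by blast
qed

lemma form_Cauchy_const: "v \<in> D \<Longrightarrow> form_Cauchy D a (\<lambda>_. v)"
  by (simp add: form_Cauchy_def form_norm_zero)

lemma equiv_form_equiv: "equiv (Collect (form_Cauchy D a)) (form_equiv D a)"
proof (rule equivI)
  show "form_equiv D a \<subseteq> Collect (form_Cauchy D a) \<times> Collect (form_Cauchy D a)"
    by (auto simp: form_equiv_def)
  show "refl_on (Collect (form_Cauchy D a)) (form_equiv D a)"
    by (auto simp: refl_on_def form_equiv_def form_norm_zero)
  show "sym (form_equiv D a)"
  proof (rule symI)
    fix u w assume uw: "(u, w) \<in> form_equiv D a"
    have "form_norm a (w k - u k) = form_norm a (u k - w k)" for k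
      using form_norm_minus[of "u k - w k"] uw
      by (simp add: form_equiv_def form_dom_closed form_CauchyD)
    then show "(w, u) \<in> form_equiv D a"
      using uw by (simp add: form_equiv_def)
  qed
  show "trans (form_equiv D a)"
  proof (rule transI)
    fix u v w assume uv: "(u, v) \<in> form_equiv D a" and vw: "(v, w) \<in> form_equiv D a"
    then have D: "u k \<in> D" "v k \<in> D" "w k \<in> D" for k
      by (auto simp: form_equiv_def form_CauchyD)
    have "(\<lambda>k. 2 * (form_norm a (u k - v k) + form_norm a (v k - w k))) \<longlonglongrightarrow> 2 * (0 + 0)"
      using uv vw by (intro tendsto_intros) (auto simp: form_equiv_def)
    moreover have "form_norm a (u k - w k) \<le> 2 * (form_norm a (u k - v k) + form_norm a (v k - w k))" for k
      using form_norm_add[of "u k - v k" "v k - w k"] D by (simp add: form_dom_closed)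
    moreover have "0 \<le> form_norm a (u k - w k)" for k
      by (intro form_norm_nonneg form_dom_closed D)
    ultimately have "(\<lambda>k. form_norm a (u k - w k)) \<longlonglongrightarrow> 0"
      by (intro Lim_null_comparison[of "\<lambda>k. form_norm a (u k - w k)"]) auto
    then show "(u, w) \<in> form_equiv D a"
      using uv vw by (simp add: form_equiv_def)
  qed
qed

lemma form_completionD:
  assumes "U \<in> form_completion D a"
  shows "\<exists>u. u \<in> U" "u \<in> U \<Longrightarrow> form_Cauchy D a u"
    "u \<in> U \<Longrightarrow> u' \<in> U \<Longrightarrow> (\<lambda>k. form_norm a (u k - u' k)) \<longlonglongrightarrow> 0"
proof -
  note U = assms[unfolded form_completion_def]
  show "\<exists>u. u \<in> U"
    using in_quotient_imp_non_empty[OF equiv_form_equiv U] by blast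
  show "form_Cauchy D a u" if "u \<in> U"
    using in_quotient_imp_subset[OF equiv_form_equiv U] that by blast
  show "(\<lambda>k. form_norm a (u k - u' k)) \<longlonglongrightarrow> 0" if "u \<in> U" "u' \<in> U"
    using quotient_eq_iff[OF equiv_form_equiv U U that] by (simp add: form_equiv_def)
qed

lemma completion_map_tendsto:
  assumes U: "U \<in> form_completion D a" and u: "u \<in> U"
  shows "u \<longlonglongrightarrow> completion_map U"
proof -
  obtain x where x: "u \<longlonglongrightarrow> x"
    using form_Cauchy_imp_Cauchy[OF form_completionD(2)[OF U u]] by (auto simp: Cauchy_convergent_iff convergent_def)
  have "u' \<longlonglongrightarrow> x" if u': "u' \<in> U" for u'
  proof -
    have "(\<lambda>k. u' k - u k) \<longlonglongrightarrow> 0"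
      by (rule Lim_null_comparison[OF _ form_completionD(3)[OF U u' u]])
        (intro always_eventually allI norm_le_form_norm form_dom_closed
          form_CauchyD form_completionD(2)[OF U] u u')
    from tendsto_add[OF this x] show ?thesis by simp
  qed
  then have all: "\<forall>u\<in>U. u \<longlonglongrightarrow> x"
    by blast
  have "completion_map U = x"
    unfolding completion_map_def
  proof (rule the_equality)
    show "\<forall>u\<in>U. u \<longlonglongrightarrow> x" by (rule all)
  next
    fix x' assume "\<forall>u\<in>U. u \<longlonglongrightarrow> x'"
    then have "u \<longlonglongrightarrow> x'"
      using u by blast
    then show "x' = x" using x by (rule LIMSEQ_unique)
  qed
  then show ?thesis using x by simp
qed

lemma completion_form_tendsto:
  assumes U: "U \<in> form_completion D a" and W: "W \<in> form_completion D a"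
    and u: "u \<in> U" and w: "w \<in> W"
  shows "(\<lambda>k. a (u k) (w k)) \<longlonglongrightarrow> completion_form a U W"
proof -
  define K where "K = 2 / cos \<theta>"
  have K: "0 < K" using angle by (simp add: K_def cos_gt_zero_pi)
  have bd: "cmod (a x y) \<le> K * form_norm a x * form_norm a y" if "x \<in> D" "y \<in> D" for x y
    using form_bound[OF that] by (simp add: K_def)
  note CU = form_completionD(2)[OF U] and CW = form_completionD(2)[OF W]
  have split: "cmod (a x y - a x' y') \<le> K * form_norm a (x - x') * B + K * C * form_norm a (y - y')"
    if "x \<in> D" "y \<in> D" "x' \<in> D" "y' \<in> D" "form_norm a y \<le> B" "form_norm a x' \<le> C" for x y x' y' B C
  proof -
    have "a x y - a x' y' = a (x - x') y + a x' (y - y')"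
      using that by (simp add: form_diff_left form_diff_right)
    then have "cmod (a x y - a x' y') \<le> cmod (a (x - x') y) + cmod (a x' (y - y'))"
      by (simp add: norm_triangle_ineq)
    also have "\<dots> \<le> K * form_norm a (x - x') * form_norm a y + K * form_norm a x' * form_norm a (y - y')"
      by (intro add_mono bd form_dom_closed that)
    also have "\<dots> \<le> K * form_norm a (x - x') * B + K * C * form_norm a (y - y')"
      using that K by (intro add_mono mult_mono order_refl mult_nonneg_nonneg)
        (auto simp: form_norm_nonneg form_dom_closed intro: order_trans[OF form_norm_nonneg])
    finally show ?thesis .
  qed
  obtain B where B: "0 < B" "\<And>k. form_norm a (w k) \<le> B"
    using form_Cauchy_bounded[OF CW[OF w]] by blast
  obtain C where C: "0 < C" "\<And>k. form_norm a (u k) \<le> C"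
    using form_Cauchy_bounded[OF CU[OF u]] by blast
  have uD: "u k \<in> D" and wD: "w k \<in> D" for k
    using form_CauchyD(1) CU[OF u] CW[OF w] by blast+
  have "Cauchy (\<lambda>k. a (u k) (w k))"
  proof (rule metric_CauchyI)
    fix e :: real assume e: "0 < e"
    obtain N1 where N1: "\<forall>m\<ge>N1. \<forall>n\<ge>N1. form_norm a (u m - u n) < e / (2 * K * B)"
      using form_CauchyD(2)[OF CU[OF u], of "e / (2 * K * B)"] e K B by auto
    obtain N2 where N2: "\<forall>m\<ge>N2. \<forall>n\<ge>N2. form_norm a (w m - w n) < e / (2 * K * C)"
      using form_CauchyD(2)[OF CW[OF w], of "e / (2 * K * C)"] e K C by auto
    have "dist (a (u m) (w m)) (a (u n) (w n)) < e" if "m \<ge> max N1 N2" "n \<ge> max N1 N2" for m n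
    proof -
      have "K * form_norm a (u m - u n) * B < e / 2"
      proof -
        have "form_norm a (u m - u n) < e / (2 * K * B)" using N1 that by simp
        then show ?thesis using K B by (simp add: field_simps)
      qed
      moreover have "K * C * form_norm a (w m - w n) < e / 2"
      proof -
        have "form_norm a (w m - w n) < e / (2 * K * C)" using N2 that by simp
        then show ?thesis using K C by (simp add: field_simps)
      qed
      ultimately show ?thesis
        using split[of "u m" "w m" "u n" "w n" B C] uD wD B C by (simp add: dist_norm)
    qed
    then show "\<exists>M. \<forall>m\<ge>M. \<forall>n\<ge>M. dist (a (u m) (w m)) (a (u n) (w n)) < e"
      by blast
  qed
  then obtain z where z: "(\<lambda>k. a (u k) (w k)) \<longlonglongrightarrow> z"
    by (auto simp: Cauchy_convergent_iff convergent_def)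
  have "(\<lambda>k. a (u' k) (w' k)) \<longlonglongrightarrow> z" if u': "u' \<in> U" and w': "w' \<in> W" for u' w'
  proof -
    obtain B' where B': "0 < B'" "\<And>k. form_norm a (w' k) \<le> B'"
      using form_Cauchy_bounded[OF CW[OF w']] by blast
    have D': "u' k \<in> D" "w' k \<in> D" for k
      using form_CauchyD(1) CU[OF u'] CW[OF w'] by blast+
    have "(\<lambda>k. K * form_norm a (u' k - u k) * B' + K * C * form_norm a (w' k - w k)) \<longlonglongrightarrow> K * 0 * B' + K * C * 0"
      by (intro tendsto_intros form_completionD(3)[OF U u' u] form_completionD(3)[OF W w' w])
    then have "(\<lambda>k. K * form_norm a (u' k - u k) * B' + K * C * form_norm a (w' k - w k)) \<longlonglongrightarrow> 0"
      by simp
    then have "(\<lambda>k. a (u' k) (w' k) - a (u k) (w k)) \<longlonglongrightarrow> 0"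
      by (rule Lim_null_comparison[rotated])
        (intro always_eventually allI split uD wD D' B' C)
    from tendsto_add[OF this z] show ?thesis by simp
  qed
  then have all: "\<forall>u\<in>U. \<forall>w\<in>W. (\<lambda>k. a (u k) (w k)) \<longlonglongrightarrow> z"
    by blast
  have "completion_form a U W = z"
    unfolding completion_form_def
  proof (rule the_equality)
    show "\<forall>u\<in>U. \<forall>w\<in>W. (\<lambda>k. a (u k) (w k)) \<longlonglongrightarrow> z" by (rule all)
  next
    fix z' assume "\<forall>u\<in>U. \<forall>w\<in>W. (\<lambda>k. a (u k) (w k)) \<longlonglongrightarrow> z'"
    then have "(\<lambda>k. a (u k) (w k)) \<longlonglongrightarrow> z'"
      using u w by blast
    then show "z' = z" using z by (rule LIMSEQ_unique)
  qed
  then show ?thesis using z by simp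
qed

lemma const_in_class:
  assumes "v \<in> D"
  shows "form_equiv D a `` {\<lambda>_. v} \<in> form_completion D a" "(\<lambda>_. v) \<in> form_equiv D a `` {\<lambda>_. v}"
proof -
  have C: "(\<lambda>_. v) \<in> Collect (form_Cauchy D a)"
    using form_Cauchy_const[OF assms] by simp
  show "form_equiv D a `` {\<lambda>_. v} \<in> form_completion D a"
    unfolding form_completion_def using C by (rule quotientI)
  show "(\<lambda>_. v) \<in> form_equiv D a `` {\<lambda>_. v}"
    using equiv_class_self[OF equiv_form_equiv C] .
qed

lemma completion_map_const:
  assumes "v \<in> D"
  shows "completion_map (form_equiv D a `` {\<lambda>_. v}) = v"
  using completion_map_tendsto[OF const_in_class[OF assms]] by (simp add: LIMSEQ_const_iff)

lemma completion_form_const: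
  assumes "u \<in> D" "v \<in> D"
  shows "completion_form a (form_equiv D a `` {\<lambda>_. u}) (form_equiv D a `` {\<lambda>_. v}) = a u v"
  using completion_form_tendsto[OF const_in_class(1)[OF assms(1)] const_in_class(1)[OF assms(2)]
      const_in_class(2)[OF assms(1)] const_in_class(2)[OF assms(2)]]
  by (simp add: LIMSEQ_const_iff)

end

end

theory Submission
  imports Defs
begin

text \<open>Put \<open>b\<^sub>n = a\<^sub>n + cinner\<close>; the resolvent \<open>x\<^sub>n\<close> of the \<open>n\<close>-th relation at \<open>f\<close> is the limit of
  approximate solutions \<open>u \<in> D n\<close> of \<open>b\<^sub>n u = cinner f\<close>. Its convergence is obtained without
  completions. Consider sequences \<open>u\<^sub>n \<in> D n\<close> of bounded energy that are Cauchy in the sense that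
  both \<open>Re b\<^sub>n (u\<^sub>m - u\<^sub>n)\<close> and \<open>Re b\<^sub>m u\<^sub>m - Re b\<^sub>n u\<^sub>m\<close> are small for \<open>m \<ge> n\<close> large. For such \<open>u\<close>,
  representing the residual \<open>b\<^sub>n u\<^sub>n - cinner f\<close> by some \<open>w\<^sub>n\<close> in the Hermitian part of \<open>b\<^sub>n\<close> (up to
  errors tending to \<open>0\<close>) gives again such a sequence \<open>w\<close>. Hence the Richardson iteration
  \<open>u \<mapsto> u - \<rho> w\<close> can be repeated, and for suitable \<open>\<rho>\<close> it contracts the residual energies by a
  factor that depends on \<open>\<theta>\<close> only. So \<open>x\<^sub>n\<close> is approximated, uniformly in large \<open>n\<close>, by Cauchy
  sequences in \<open>H\<close>. The limit operator \<open>S\<close> of the resolvents is linear and gives the relation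
  \<open>{(S f, f - S f)}\<close>.\<close>

section \<open>Sectors and sectorial forms\<close>

text \<open>The cone inequality is additive and homogeneous, unlike the definition by
  \<open>Arg\<close>. For its sufficiency, shift the point by a small positive real: the shifted
  point lies in the open sector, and the shifts tend to 0.\<close>

lemma closure_sector_iff:
  assumes "0 \<le> \<theta>" "\<theta> < pi / 2"
  shows "z \<in> closure (sector \<theta>) \<longleftrightarrow> cos \<theta> * cmod z \<le> Re z"
proof
  show "cos \<theta> * cmod z \<le> Re z" if "z \<in> closure (sector \<theta>)"
    using closure_sector_bound[OF assms that] .
next
  assume z: "cos \<theta> * cmod z \<le> Re z"
  have "z + of_real (inverse (real (Suc n))) \<in> sector \<theta>" for n
  proof -
    define e where "e = inverse (real (Suc n))"
    have e: "0 < e" by (simp add: e_def)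
    define w where "w = z + of_real e"
    have c0: "0 < cos \<theta>"
      using assms by (intro cos_gt_zero_pi) auto
    then have "0 \<le> cos \<theta> * cmod z" by simp
    then have Rez: "0 \<le> Re z" using z by linarith
    have w0: "w \<noteq> 0" using e Rez by (auto simp: w_def complex_eq_iff)
    \<comment> \<open>\<open>sector 0\<close> is the open half-line, a separate clause of the
      definition; here the inequality forces \<open>z\<close> to be real and nonnegative, so the
      shift makes it positive.\<close>
    show ?thesis
    proof (cases "\<theta> = 0")
      case True
      then have "cmod z = Re z" using z complex_Re_le_cmod[of z] by simp
      then have "Im z = 0" using cmod_power2[of z] by simp
      then have "w = of_real (Re z + e)" by (simp add: w_def complex_eq_iff)
      moreover have "0 < Re z + e" using e Rez by simp
      ultimately show ?thesis
        using True by (simp add: sector_def w_def e_def del: of_real_add)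
    next
      case False
      then have c1: "cos \<theta> < 1"
        using assms cos_monotone_0_pi[of 0 \<theta>] by simp
      have "cmod w \<le> cmod z + e"
        unfolding w_def using norm_triangle_ineq[of z "of_real e"] e by simp
      \<comment> \<open>The inequality becomes strict after the shift because
        \<open>cos \<theta> * e < e\<close>.\<close>
      then have "cos \<theta> * cmod w \<le> cos \<theta> * cmod z + cos \<theta> * e"
        using mult_left_mono[OF _ less_imp_le[OF c0]] by (metis distrib_left)
      also have "\<dots> < Re z + e" using z c1 e by (simp add: add_le_less_mono)
      finally have "cos \<theta> * cmod w < Re w" by (simp add: w_def)
      moreover have "Re w = cmod w * cos (Arg w)"
        using arg_cong[OF Arg_eq[OF w0], of Re] by (simp add: Re_exp)
      ultimately have "cos \<theta> < cos \<bar>Arg w\<bar>"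
        using w0 by (simp add: mult.commute)
      then have "\<bar>Arg w\<bar> < \<theta>"
        using cos_monotone_0_pi_le[of \<theta> "\<bar>Arg w\<bar>"] assms Arg_le_pi[of w] mpi_less_Arg[of w]
        by linarith
      then show ?thesis using w0 False by (simp add: sector_def w_def e_def)
    qed
  qed
  moreover have "(\<lambda>n. z + of_real (inverse (real (Suc n)))) \<longlonglongrightarrow> z + of_real 0"
    by (intro tendsto_intros LIMSEQ_inverse_real_of_nat)
  ultimately show "z \<in> closure (sector \<theta>)"
    unfolding closure_sequential by (intro exI[of _ "\<lambda>n. z + of_real (inverse (real (Suc n)))"]) simp
qed

definition energy :: "('a \<Rightarrow> 'a \<Rightarrow> complex) \<Rightarrow> 'a \<Rightarrow> real" where
  "energy q u = Re (q u u)"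

text \<open>For a sectorial \<open>q\<close> this is the positive semidefinite Hermitian form with
  quadratic form \<open>energy q\<close>. It serves as the semi-inner product in which residuals are
  represented.\<close>

definition hermitian_part :: "('a \<Rightarrow> 'a \<Rightarrow> complex) \<Rightarrow> 'a \<Rightarrow> 'a \<Rightarrow> complex" where
  "hermitian_part q u v = (q u v + cnj (q v u)) / 2"

lemma sectorial_form_subset:
  assumes "sectorial_form \<theta> D q" "csubspace D'" "D' \<subseteq> D"
  shows "sectorial_form \<theta> D' q"
proof -
  have sub: "\<And>u. u \<in> D' \<Longrightarrow> u \<in> D" using assms(3) by blast
  show ?thesis
    using assms(1,2) unfolding sectorial_form_def sesquilinear_on_def by (simp add: sub)
qed

lemma sectorial_form_iff:
  assumes "0 \<le> \<theta>" "\<theta> < pi / 2"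
  shows "sectorial_form \<theta> D q \<longleftrightarrow>
    csubspace D \<and> sesquilinear_on D q \<and> (\<forall>u\<in>D. cos \<theta> * cmod (q u u) \<le> energy q u)"
  by (simp add: sectorial_form_def closure_sector_iff[OF assms] energy_def)

lemma sesquilinear_on_add:
  "sesquilinear_on D p \<Longrightarrow> sesquilinear_on D q \<Longrightarrow> sesquilinear_on D (\<lambda>u v. p u v + q u v)"
  by (simp add: sesquilinear_on_def distrib_left)

text \<open>The closed sector is a convex cone, so adding forms does not enlarge the angle. Both the
  shift by the inner product and the telescoping of increments rest on this.\<close>

lemma sectorial_form_add:
  assumes angle: "0 \<le> \<theta>" "\<theta> < pi / 2"
    and p: "sectorial_form \<theta> D p" and q: "sectorial_form \<theta> D q"
  shows "sectorial_form \<theta> D (\<lambda>u v. p u v + q u v)"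
proof -
  have c: "0 \<le> cos \<theta>" using angle by (intro cos_ge_zero) auto
  have "cos \<theta> * cmod (p u u + q u u) \<le> energy p u + energy q u" if "u \<in> D" for u
  proof -
    have "cos \<theta> * cmod (p u u + q u u) \<le> cos \<theta> * (cmod (p u u) + cmod (q u u))"
      using c by (intro mult_left_mono norm_triangle_ineq)
    then show ?thesis
      using p q that unfolding sectorial_form_iff[OF angle] by (fastforce simp: distrib_left)
  qed
  then show ?thesis
    using p q unfolding sectorial_form_iff[OF angle] by (simp add: sesquilinear_on_add energy_def)
qed

lemma sectorial_form_scale:
  assumes angle: "0 \<le> \<theta>" "\<theta> < pi / 2" and q: "sectorial_form \<theta> D q" and t: "0 < t"
  shows "sectorial_form \<theta> D (\<lambda>u v. of_real t * q u v)"
proof -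
  have "cos \<theta> * (t * cmod (q u u)) \<le> t * energy q u" if "u \<in> D" for u
  proof -
    have "t * (cos \<theta> * cmod (q u u)) \<le> t * energy q u"
      using q that t unfolding sectorial_form_iff[OF angle] by (intro mult_left_mono) auto
    then show ?thesis by (simp add: algebra_simps)
  qed
  then show ?thesis
    using q t unfolding sectorial_form_iff[OF angle]
    by (auto simp: sesquilinear_on_def norm_mult energy_def algebra_simps)
qed

section \<open>The inner product as a sectorial form, and its continuity\<close>

lemma cinner_add_right: "cinner x (y + z) = cinner x y + cinner x z"
  for x y z :: "'a::complex_hilbert_space"
  using cinner_commute[of x "y + z"] cinner_commute[of x y] cinner_commute[of x z]
  by (simp add: cinner_add_left)

lemma cinner_scaleC_right: "cinner x (c *\<^sub>C y) = cnj c * cinner x y"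
  for x y :: "'a::complex_hilbert_space"
  using cinner_commute[of x "c *\<^sub>C y"] cinner_commute[of x y]
  by (simp add: cinner_scaleC_left)

lemma cinner_self: "cinner x x = of_real ((norm x)\<^sup>2)"
  for x :: "'a::complex_hilbert_space"
  using cinner_commute[of x x] by (simp add: complex_eq_iff power2_norm_eq_cinner)

lemma sectorial_form_cinner:
  assumes "0 \<le> \<theta>" "\<theta> < pi / 2"
  shows "sectorial_form \<theta> UNIV (cinner :: 'a::complex_hilbert_space \<Rightarrow> _)"
proof -
  have "cos \<theta> * (norm x)\<^sup>2 \<le> 1 * (norm x)\<^sup>2" for x :: 'a
    by (intro mult_right_mono) auto
  then show ?thesis
    unfolding sectorial_form_iff[OF assms] sesquilinear_on_def energy_def
    by (simp add: cinner_add_left cinner_add_right cinner_scaleC_left cinner_scaleC_right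
        cinner_self complex_vector.subspace_UNIV norm_power)
qed

text \<open>\<open>form_bound\<close> applied to \<open>t q\<close> carries the extra terms \<open>(norm u)\<^sup>2 / t\<close>; they
  disappear as \<open>t \<rightarrow> \<infinity>\<close>.\<close>

lemma sectorial_Cauchy_Schwarz:
  assumes angle: "0 \<le> \<theta>" "\<theta> < pi / 2" and q: "sectorial_form \<theta> D q" and uv: "u \<in> D" "v \<in> D"
  shows "cmod (q u v) \<le> 2 / cos \<theta> * sqrt (energy q u) * sqrt (energy q v)"
proof (rule tendsto_lowerbound)
  let ?B = "\<lambda>e. 2 / cos \<theta> * sqrt (energy q u + e * (norm u)\<^sup>2) * sqrt (energy q v + e * (norm v)\<^sup>2)"
  have "((\<lambda>n. ?B (inverse (real (Suc n)))) \<longlonglongrightarrow> ?B 0)"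
    by (intro tendsto_intros LIMSEQ_inverse_real_of_nat)
  then show "(\<lambda>n. ?B (inverse (real (Suc n)))) \<longlonglongrightarrow> 2 / cos \<theta> * sqrt (energy q u) * sqrt (energy q v)"
    by simp
  show "\<forall>\<^sub>F n in sequentially. cmod (q u v) \<le> ?B (inverse (real (Suc n)))"
  proof (intro always_eventually allI)
    fix n
    define t where "t = real (Suc n)"
    have t: "0 < t" by (simp add: t_def)
    have "t * energy q x + (norm x)\<^sup>2 = t * (energy q x + inverse t * (norm x)\<^sup>2)" for x
      using t by (simp add: field_simps)
    then have N: "form_norm (\<lambda>u v. of_real t * q u v) x = sqrt t * sqrt (energy q x + inverse t * (norm x)\<^sup>2)" for x
      by (simp add: form_norm_def energy_def real_sqrt_mult)
    have "t * cmod (q u v) \<le> 2 / cos \<theta> * (sqrt t * sqrt (energy q u + inverse t * (norm u)\<^sup>2)) *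
        (sqrt t * sqrt (energy q v + inverse t * (norm v)\<^sup>2))"
      using form_bound[OF angle sectorial_form_scale[OF angle q t] uv] t by (simp add: N norm_mult)
    also have "\<dots> = t * ?B (inverse t)"
      using t by (simp add: algebra_simps)
    finally have "cmod (q u v) \<le> ?B (inverse t)"
      using t by (rule mult_left_le_imp_le)
    then show "cmod (q u v) \<le> ?B (inverse (real (Suc n)))"
      by (simp only: t_def)
  qed
qed simp

text \<open>The inner product is a form of angle 0, so the bound for sectorial forms applies with
  \<open>cos 0 = 1\<close>. The constant 2 is not sharp but suffices for continuity.\<close>

lemma norm_cinner_le: "cmod (cinner x y) \<le> 2 * norm x * norm y"
  for x y :: "'a::complex_hilbert_space"
  using sectorial_Cauchy_Schwarz[OF _ _ sectorial_form_cinner, of 0 x y]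
  by (simp add: energy_def cinner_self)

lemma bounded_bilinear_cinner: "bounded_bilinear (cinner :: 'a::complex_hilbert_space \<Rightarrow> _)"
proof
  show "\<exists>K. \<forall>a b::'a. cmod (cinner a b) \<le> norm a * norm b * K"
    by (intro exI[of _ 2] allI order_trans[OF norm_cinner_le]) simp
qed (simp_all add: cinner_add_left cinner_add_right scaleR_scaleC cinner_scaleC_left
    cinner_scaleC_right scaleR_conv_of_real scaleC_complex_def)

lemmas tendsto_cinner = bounded_bilinear.tendsto[OF bounded_bilinear_cinner]

lemma tendsto_scaleC:
  fixes f :: "'b \<Rightarrow> 'a::complex_hilbert_space"
  assumes "(f \<longlongrightarrow> l) F"
  shows "((\<lambda>x. c *\<^sub>C f x) \<longlongrightarrow> c *\<^sub>C l) F"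
proof -
  have "norm (c *\<^sub>C x) = norm x * cmod c" for x :: 'a
  proof (rule power2_eq_imp_eq)
    have "cinner (c *\<^sub>C x) (c *\<^sub>C x) = c * cnj c * cinner x x"
      by (simp only: cinner_scaleC_left cinner_scaleC_right mult_ac)
    also have "\<dots> = of_real ((cmod c)\<^sup>2 * (norm x)\<^sup>2)"
      by (simp only: complex_norm_square[symmetric] cinner_self of_real_mult)
    finally show "(norm (c *\<^sub>C x))\<^sup>2 = (norm x * cmod c)\<^sup>2"
      by (simp add: power2_norm_eq_cinner[of "c *\<^sub>C x"] power_mult_distrib)
  qed auto
  then have "bounded_linear (\<lambda>x::'a. c *\<^sub>C x)"
    by (intro bounded_linear_intro[of _ "cmod c"])
      (simp_all add: scaleC_add_right scaleR_scaleC scaleC_scaleC mult.commute)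
  then show ?thesis using assms by (rule bounded_linear.tendsto)
qed

section \<open>Approximate Riesz representation\<close>

lemma le_if_square_le:
  fixes x c :: real
  assumes "0 \<le> x" "0 \<le> c" "x * x \<le> c * x"
  shows "x \<le> c"
proof (cases "x = 0")
  case False
  then have "0 < x" using assms(1) by simp
  with assms(3) show ?thesis by (rule mult_right_le_imp_le)
qed (use assms in simp)

context
  fixes \<theta> :: real and D :: "'a::complex_hilbert_space set" and b :: "'a \<Rightarrow> 'a \<Rightarrow> complex"
  assumes angle: "0 \<le> \<theta>" "\<theta> < pi / 2" and b: "sectorial_form \<theta> D b"
begin

lemmas D_closed = form_dom_closed[OF angle b]

lemma energy_nonneg: "u \<in> D \<Longrightarrow> 0 \<le> energy b u"
  using form_Re_nonneg[OF angle b] by (simp add: energy_def)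

lemma energy_add_scaleC:
  assumes "u \<in> D" "v \<in> D"
  shows "energy b (u + c *\<^sub>C v) =
    energy b u + 2 * Re (cnj c * hermitian_part b u v) + (cmod c)\<^sup>2 * energy b v"
proof -
  have "b (u + c *\<^sub>C v) (u + c *\<^sub>C v) = b u u + cnj c * b u v + c * b v u + c * cnj c * b v v"
    using assms by (simp add: D_closed form_add_left[OF angle b] form_add_right[OF angle b]
        form_scaleC_left[OF angle b] form_scaleC_right[OF angle b] algebra_simps)
  moreover have "Re (c * b v u) = Re (cnj c * cnj (b v u))"
    by (metis complex_cnj_mult complex_cnj_cnj cnj.simps(1))
  ultimately show ?thesis
    by (simp add: energy_def hermitian_part_def field_simps flip: complex_norm_square)
qed

lemma energy_diff:
  assumes "u \<in> D" "v \<in> D"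
  shows "energy b (u - v) = energy b u - 2 * Re (hermitian_part b v u) + energy b v"
  using energy_add_scaleC[OF assms, of "-1"] by (simp add: hermitian_part_def field_simps)

lemma energy_scaleC: "u \<in> D \<Longrightarrow> energy b (c *\<^sub>C u) = (cmod c)\<^sup>2 * energy b u"
  using energy_add_scaleC[of 0 u c] D_closed(1)
  by (simp add: energy_def hermitian_part_def form_zero_left[OF angle b] form_zero_right[OF angle b])

lemma energy_diff_le:
  assumes "u \<in> D" "v \<in> D"
  shows "energy b (u - v) \<le> 2 * energy b u + 2 * energy b v"
proof -
  have "energy b (u + v) = energy b u + 2 * Re (hermitian_part b u v) + energy b v"
    using energy_add_scaleC[OF assms, of 1] by simp
  moreover have "Re (hermitian_part b u v) = Re (hermitian_part b v u)"
    by (simp add: hermitian_part_def)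
  moreover have "0 \<le> energy b (u + v)"
    using assms by (intro energy_nonneg D_closed)
  ultimately show ?thesis using energy_diff[OF assms] by linarith
qed

lemma form_le_energy:
  "u \<in> D \<Longrightarrow> v \<in> D \<Longrightarrow> cmod (b u v) \<le> 2 / cos \<theta> * sqrt (energy b u) * sqrt (energy b v)"
  by (rule sectorial_Cauchy_Schwarz[OF angle b])

lemma hermitian_part_le_energy:
  assumes "u \<in> D" "v \<in> D"
  shows "cmod (hermitian_part b u v) \<le> 2 / cos \<theta> * sqrt (energy b u) * sqrt (energy b v)"
proof -
  have "cmod (hermitian_part b u v) = cmod (b u v + cnj (b v u)) / 2"
    by (simp add: hermitian_part_def norm_divide)
  also have "\<dots> \<le> (cmod (b u v) + cmod (b v u)) / 2"
    using norm_triangle_ineq[of "b u v" "cnj (b v u)"] by simp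
  finally show ?thesis
    using form_le_energy[OF assms] form_le_energy[OF assms(2,1)] by (simp add: mult.commute mult.left_commute)
qed

lemma hermitian_part_self: "Re (hermitian_part b u u) = energy b u"
  by (simp add: hermitian_part_def energy_def)

text \<open>The representative is an almost minimizer \<open>w\<close> of \<open>energy b w - 2 Re (G w)\<close>.\<close>

lemma approximate_Riesz:
  fixes G :: "'a \<Rightarrow> complex"
  assumes add: "\<And>u v. u \<in> D \<Longrightarrow> v \<in> D \<Longrightarrow> G (u + v) = G u + G v"
    and scale: "\<And>c u. u \<in> D \<Longrightarrow> G (c *\<^sub>C u) = cnj c * G u"
    and bound: "\<And>u. u \<in> D \<Longrightarrow> cmod (G u) \<le> C * sqrt (energy b u)"
    and C: "0 \<le> C" and e: "0 < e"
  obtains w where "w \<in> D" "\<And>v. v \<in> D \<Longrightarrow> cmod (hermitian_part b w v - G v) \<le> e * sqrt (energy b v)"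
    "sqrt (energy b w) \<le> C + e"
proof -
  define J where "J w = energy b w - 2 * Re (G w)" for w
  \<comment> \<open>Completing the square in \<open>sqrt (energy b w)\<close> bounds the functional
    from below.\<close>
  have J_ge: "- C\<^sup>2 \<le> J w" if "w \<in> D" for w
  proof -
    have "Re (G w) \<le> C * sqrt (energy b w)"
      using bound[OF that] complex_Re_le_cmod[of "G w"] by linarith
    moreover have "(sqrt (energy b w))\<^sup>2 = energy b w"
      using energy_nonneg[OF that] by simp
    moreover have "0 \<le> (sqrt (energy b w) - C)\<^sup>2" by simp
    ultimately show ?thesis unfolding J_def power2_diff by (simp add: mult.commute)
  qed
  have ne: "J ` D \<noteq> {}" using D_closed(1) by blast
  have bdd: "bdd_below (J ` D)" using J_ge by (intro bdd_belowI[of _ "- C\<^sup>2"]) auto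
  \<comment> \<open>The slack is the square of \<open>e\<close> because the gain of an optimal
    perturbation of \<open>w\<close> is quadratic in the representation error.\<close>
  have "Inf (J ` D) < Inf (J ` D) + e\<^sup>2" using e by simp
  then obtain w where w: "w \<in> D" "J w < Inf (J ` D) + e\<^sup>2"
    using cInf_less_iff[OF ne bdd] by blast
  have min: "J w \<le> J v + e\<^sup>2" if "v \<in> D" for v
    using w(2) cInf_lower[OF _ bdd, of "J v"] that by fastforce
  have app: "cmod (hermitian_part b w v - G v) \<le> e * sqrt (energy b v)" if v: "v \<in> D" for v
  \<comment> \<open>A direction of zero energy admits no optimal step length, but there both the
    form and \<open>G\<close> vanish by their bounds.\<close>
  proof (cases "energy b v = 0")
    case True
    then show ?thesis using hermitian_part_le_energy[OF w(1) v] bound[OF v] by simp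
  next
    case False
    define g where "g = hermitian_part b w v - G v"
    define N where "N = energy b v"
    have N: "0 < N" using False energy_nonneg[OF v] by (simp add: N_def)
    \<comment> \<open>This \<open>c\<close> minimizes \<open>J (w + c *\<^sub>C v)\<close>. It
      lowers \<open>J\<close> by \<open>(cmod g)\<^sup>2 / N\<close>, which cannot exceed the
      slack.\<close>
    define c where "c = - (g / of_real N)"
    have cg: "Re (cnj c * g) = - (cmod g)\<^sup>2 / N"
    proof -
      have "cnj c * g = - (of_real ((cmod g)\<^sup>2 / N))"
        unfolding of_real_divide complex_norm_square by (simp add: c_def)
      then show ?thesis by simp
    qed
    have cN: "(cmod c)\<^sup>2 * N = (cmod g)\<^sup>2 / N"
      using N by (simp add: c_def norm_divide power_divide power2_eq_square)
    have "J (w + c *\<^sub>C v) = J w + 2 * Re (cnj c * g) + (cmod c)\<^sup>2 * N"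
      unfolding J_def energy_add_scaleC[OF w(1) v] g_def N_def
      using add[OF w(1) D_closed(4)[OF v]] scale[OF v] by (simp add: algebra_simps)
    then have "J (w + c *\<^sub>C v) = J w - (cmod g)\<^sup>2 / N"
      unfolding cg cN by simp
    then have "(cmod g)\<^sup>2 / N \<le> e\<^sup>2"
      using min[OF D_closed(2)[OF w(1) D_closed(4)[OF v]], of c] by simp
    then have "(cmod g)\<^sup>2 \<le> e\<^sup>2 * N"
      using N by (simp add: pos_divide_le_eq)
    also have "e\<^sup>2 * N = (e * sqrt N)\<^sup>2"
      using N by (simp add: power_mult_distrib)
    finally have "cmod g \<le> e * sqrt N"
      by (rule power2_le_imp_le) (use e N in simp)
    then show ?thesis
      by (simp only: g_def N_def)
  qed
  \<comment> \<open>Testing the approximate representation with \<open>w\<close> itself gives its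
    energy bound.\<close>
  have "energy b w \<le> (C + e) * sqrt (energy b w)"
  proof -
    have "energy b w \<le> cmod (hermitian_part b w w)"
      using hermitian_part_self[of w] complex_Re_le_cmod[of "hermitian_part b w w"] by simp
    also have "\<dots> \<le> cmod (hermitian_part b w w - G w) + cmod (G w)"
      using norm_triangle_ineq[of "hermitian_part b w w - G w" "G w"] by simp
    finally show ?thesis using app[OF w(1)] bound[OF w(1)] by (simp add: distrib_right)
  qed
  then have "sqrt (energy b w) * sqrt (energy b w) \<le> (C + e) * sqrt (energy b w)"
    using energy_nonneg[OF w(1)] by simp
  from le_if_square_le[OF _ _ this] have "sqrt (energy b w) \<le> C + e"
    using C e energy_nonneg[OF w(1)] by simp
  with w(1) app show ?thesis by (rule that)
qed

lemma hermitian_part_add_scaleC_left: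
  assumes "u \<in> D" "v \<in> D" "x \<in> D"
  shows "hermitian_part b (u + c *\<^sub>C v) x = hermitian_part b u x + c * hermitian_part b v x"
  using assms by (simp add: hermitian_part_def D_closed form_add_left[OF angle b]
      form_add_right[OF angle b] form_scaleC_left[OF angle b] form_scaleC_right[OF angle b] field_simps)

text \<open>Subtract the two equations and test with \<open>y - u\<close>: the real part on the left
  is the energy of \<open>y - u\<close>, and everything on the right is at most a constant times its
  root. With \<open>w = 0\<close> this compares two approximate solutions; with small
  \<open>w\<close> it measures how far an iterate is from a solution.\<close>

lemma approximate_solution_unique:
  fixes F :: "'a \<Rightarrow> complex"
  assumes D: "y \<in> D" "u \<in> D" "w \<in> D" and e: "0 \<le> e" "0 \<le> e'"
    and y: "\<And>v. v \<in> D \<Longrightarrow> cmod (b y v - F v) \<le> e * sqrt (energy b v)"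
    and u: "\<And>v. v \<in> D \<Longrightarrow> cmod (hermitian_part b w v - (b u v - F v)) \<le> e' * sqrt (energy b v)"
  shows "sqrt (energy b (y - u)) \<le> 2 / cos \<theta> * sqrt (energy b w) + e + e'"
proof -
  define v where "v = y - u"
  define N where "N = sqrt (energy b v)"
  have v: "v \<in> D" unfolding v_def using D by (intro D_closed)
  have N: "0 \<le> N" "energy b v = N * N" using energy_nonneg[OF v] by (simp_all add: N_def)
  have "N * N = Re (b y v - b u v)"
    unfolding N(2)[symmetric] using D v by (simp add: energy_def v_def form_diff_left[OF angle b])
  also have "b y v - b u v = (b y v - F v) + (hermitian_part b w v - (b u v - F v)) - hermitian_part b w v"
    by simp
  also have "Re \<dots> \<le> cmod (b y v - F v) + cmod (hermitian_part b w v - (b u v - F v)) + cmod (hermitian_part b w v)"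
    by (intro order_trans[OF complex_Re_le_cmod] order_trans[OF norm_triangle_ineq4] add_mono
        norm_triangle_ineq order_refl)
  also have "\<dots> \<le> e * N + e' * N + 2 / cos \<theta> * sqrt (energy b w) * N"
    unfolding N_def by (intro add_mono y u hermitian_part_le_energy D v)
  finally have *: "N * N \<le> (2 / cos \<theta> * sqrt (energy b w) + e + e') * N"
    by (simp add: algebra_simps)
  have "0 \<le> 2 / cos \<theta> * sqrt (energy b w)"
    using angle energy_nonneg[OF D(3)] by (simp add: cos_ge_zero)
  then have "N \<le> 2 / cos \<theta> * sqrt (energy b w) + e + e'"
    using le_if_square_le[OF N(1) _ *] e by simp
  then show ?thesis by (simp add: N_def v_def)
qed

end

section \<open>Monotone sequences of forms\<close>

text \<open>The \<open>m\<close>-th member of a sequence is compared with its \<open>n\<close>-th member (\<open>n \<le> m\<close>) in the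
  energy of level \<open>n\<close>. The second summand of \<open>oscillation\<close> makes convergent sequences behave like
  elements of the form domain of the limit.\<close>

definition oscillation ::
    "(nat \<Rightarrow> 'a \<Rightarrow> 'a \<Rightarrow> complex) \<Rightarrow> (nat \<Rightarrow> 'a::minus) \<Rightarrow> nat \<Rightarrow> nat \<Rightarrow> real" where
  "oscillation b u n m = energy (b n) (u m - u n) + (energy (b m) (u m) - energy (b n) (u m))"

definition form_convergent ::
    "(nat \<Rightarrow> 'a::minus set) \<Rightarrow> (nat \<Rightarrow> 'a \<Rightarrow> 'a \<Rightarrow> complex) \<Rightarrow> (nat \<Rightarrow> 'a) \<Rightarrow> bool" where
  "form_convergent D b u \<longleftrightarrow> (\<forall>n. u n \<in> D n) \<and>
     (\<exists>C. \<forall>\<^sub>F n in sequentially. energy (b n) (u n) \<le> C) \<and>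
     (\<forall>e>0. \<exists>N. \<forall>n\<ge>N. \<forall>m\<ge>n. oscillation b u n m \<le> e)"

text \<open>One \<open>\<epsilon> n\<close> serves all \<open>v\<close>: the error is measured in
  the dual of the energy norm at level \<open>n\<close>. It cannot be 0 in general since
  representatives are only almost minimizers.\<close>

definition residual_represented ::
    "(nat \<Rightarrow> 'a set) \<Rightarrow> (nat \<Rightarrow> 'a \<Rightarrow> 'a \<Rightarrow> complex) \<Rightarrow> ('a \<Rightarrow> complex) \<Rightarrow>
      (nat \<Rightarrow> 'a) \<Rightarrow> (nat \<Rightarrow> 'a) \<Rightarrow> bool" where
  "residual_represented D b F u w \<longleftrightarrow> (\<forall>n. w n \<in> D n) \<and>
     (\<exists>\<epsilon>. \<epsilon> \<longlonglongrightarrow> 0 \<and> (\<forall>n. \<forall>v\<in>D n.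
       cmod (hermitian_part (b n) (w n) v - (b n (u n) v - F v)) \<le> \<epsilon> n * sqrt (energy (b n) v)))"

text \<open>Up to vanishing errors, \<open>s\<close> bounds the squared dual norm of the residual at
  all large levels. Solvability for every positive \<open>s\<close> replaces an exact
  solution.\<close>

definition solvable_upto ::
    "(nat \<Rightarrow> 'a::minus set) \<Rightarrow> (nat \<Rightarrow> 'a \<Rightarrow> 'a \<Rightarrow> complex) \<Rightarrow> ('a \<Rightarrow> complex) \<Rightarrow> real \<Rightarrow> bool" where
  "solvable_upto D b F s \<longleftrightarrow> (\<exists>u w. form_convergent D b u \<and> residual_represented D b F u w \<and>
     (\<forall>\<^sub>F n in sequentially. energy (b n) (w n) \<le> s))"

lemma solvable_upto_mono: "solvable_upto D b F s \<Longrightarrow> s \<le> s' \<Longrightarrow> solvable_upto D b F s'"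
  unfolding solvable_upto_def by (blast intro: eventually_mono order_trans)

text \<open>Once a term is within \<open>e / 2\<close> of the infimum of a tail, almost monotonicity
  keeps all later terms within \<open>e\<close> of that infimum.\<close>

lemma almost_decreasing_Cauchy:
  fixes x :: "nat \<Rightarrow> real"
  assumes lower: "\<And>n. 0 \<le> x n"
    and dec: "\<And>e. 0 < e \<Longrightarrow> \<exists>N. \<forall>n\<ge>N. \<forall>m\<ge>n. x m \<le> x n + e"
    and e: "0 < e"
  shows "\<exists>N. \<forall>n\<ge>N. \<forall>m\<ge>n. x n - x m \<le> e"
proof -
  obtain N where N: "\<And>n m. n \<ge> N \<Longrightarrow> m \<ge> n \<Longrightarrow> x m \<le> x n + e / 2"
    using dec[of "e / 2"] e by auto
  have bdd: "bdd_below (x ` {N..})" using lower by (intro bdd_belowI[of _ 0]) auto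
  have "Inf (x ` {N..}) < Inf (x ` {N..}) + e / 2" using e by simp
  then obtain n0 where n0: "n0 \<ge> N" "x n0 < Inf (x ` {N..}) + e / 2"
    using cInf_less_iff[OF _ bdd, of "Inf (x ` {N..}) + e / 2"] by auto
  have "x n - x m \<le> e" if "n \<ge> n0" "m \<ge> n" for n m
  proof -
    have "Inf (x ` {N..}) \<le> x m" using that n0 by (intro cInf_lower bdd) auto
    then show ?thesis using N[OF n0(1) that(1)] n0(2) by linarith
  qed
  then show ?thesis by blast
qed

context
  fixes \<theta> :: real and D :: "nat \<Rightarrow> 'a::complex_hilbert_space set"
    and b :: "nat \<Rightarrow> 'a \<Rightarrow> 'a \<Rightarrow> complex"
  assumes angle: "0 \<le> \<theta>" "\<theta> < pi / 2"
    and b: "\<And>n. sectorial_form \<theta> (D n) (b n)"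
    and D_Suc: "\<And>n. D (Suc n) \<subseteq> D n"
    and increment: "\<And>n. sectorial_form \<theta> (D (Suc n)) (\<lambda>u v. b (Suc n) u v - b n u v)"
begin

lemma D_antimono: "n \<le> m \<Longrightarrow> D m \<subseteq> D n"
  by (rule lift_Suc_antimono_le[of D]) (rule D_Suc)

text \<open>Telescoping: the difference is a sum of one-step increments restricted to
  \<open>D m\<close>, and sums keep the angle.\<close>

lemma sectorial_form_increment:
  "n \<le> m \<Longrightarrow> sectorial_form \<theta> (D m) (\<lambda>u v. b m u v - b n u v)"
proof (induction m rule: dec_induct)
  case base
  then show ?case
    using b[of n] by (simp add: sectorial_form_iff[OF angle] sesquilinear_on_def energy_def)
next
  case (step m)
  have "sectorial_form \<theta> (D (Suc m)) (\<lambda>u v. b m u v - b n u v)"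
    using step.IH b[of "Suc m"] D_Suc by (rule_tac sectorial_form_subset) (auto simp: sectorial_form_def)
  from sectorial_form_add[OF angle increment[of m] this] show ?case by simp
qed

lemma energy_increment: "energy (\<lambda>u v. b m u v - b n u v) x = energy (b m) x - energy (b n) x"
  by (simp add: energy_def)

lemma energy_mono: "n \<le> m \<Longrightarrow> x \<in> D m \<Longrightarrow> energy (b n) x \<le> energy (b m) x"
  using energy_nonneg[OF angle sectorial_form_increment] by (simp add: energy_increment)

text \<open>Both summands of the oscillation are nonnegative, the second by
  \<open>energy_mono\<close>, so each is bounded by the sum.\<close>

lemma oscillation_ge:
  assumes "\<And>n. u n \<in> D n" "n \<le> m"
  shows "energy (b n) (u m - u n) \<le> oscillation b u n m"
    "energy (b m) (u m) - energy (b n) (u m) \<le> oscillation b u n m"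
proof -
  have "u m \<in> D n" using assms D_antimono by blast
  then have "0 \<le> energy (b n) (u m - u n)"
    by (intro energy_nonneg[OF angle b] D_closed(3)[OF angle b] assms(1))
  then show "energy (b m) (u m) - energy (b n) (u m) \<le> oscillation b u n m"
    by (simp add: oscillation_def)
  show "energy (b n) (u m - u n) \<le> oscillation b u n m"
    using energy_mono[OF assms(2,1)] by (simp add: oscillation_def)
qed

lemma energy_add_scaleC_le:
  assumes "sectorial_form \<theta> X q" "x \<in> X" "y \<in> X"
  shows "energy q (x + c *\<^sub>C y) \<le> 2 * energy q x + 2 * (cmod c)\<^sup>2 * energy q y"
proof -
  have "energy q (x - (- c) *\<^sub>C y) \<le> 2 * energy q x + 2 * energy q ((- c) *\<^sub>C y)"
    by (intro energy_diff_le[OF angle assms(1)] D_closed[OF angle assms(1)] assms)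
  then show ?thesis
    using energy_scaleC[OF angle assms(1,3), of "- c"] by simp
qed

text \<open>Both summands of the oscillation are energies of sectorial forms, namely of
  \<open>b n\<close> and of the increment from \<open>b n\<close> to \<open>b m\<close>; each
  therefore obeys \<open>energy_add_scaleC_le\<close>.\<close>

lemma form_convergent_add_scaleC:
  assumes u: "form_convergent D b u" and w: "form_convergent D b w"
  shows "form_convergent D b (\<lambda>n. u n + c *\<^sub>C w n)"
  unfolding form_convergent_def
proof (intro conjI allI impI)
  have D: "u n \<in> D n" "w n \<in> D n" for n
    using u w by (auto simp: form_convergent_def)
  then show "u n + c *\<^sub>C w n \<in> D n" for n
    by (intro D_closed[OF angle b])
  obtain C C' where "\<forall>\<^sub>F n in sequentially. energy (b n) (u n) \<le> C"
    "\<forall>\<^sub>F n in sequentially. energy (b n) (w n) \<le> C'"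
    using u w by (auto simp: form_convergent_def)
  then have "\<forall>\<^sub>F n in sequentially. energy (b n) (u n + c *\<^sub>C w n) \<le> 2 * C + 2 * (cmod c)\<^sup>2 * C'"
  proof eventually_elim
    case (elim n)
    then have "2 * (cmod c)\<^sup>2 * energy (b n) (w n) \<le> 2 * (cmod c)\<^sup>2 * C'"
      by (intro mult_left_mono) auto
    then show ?case using energy_add_scaleC_le[OF b D, of n c] elim by linarith
  qed
  then show "\<exists>C. \<forall>\<^sub>F n in sequentially. energy (b n) (u n + c *\<^sub>C w n) \<le> C" by blast
  have osc: "oscillation b (\<lambda>n. u n + c *\<^sub>C w n) n m \<le>
      2 * oscillation b u n m + 2 * (cmod c)\<^sup>2 * oscillation b w n m" if nm: "n \<le> m" for n m
  proof -
    have Dn: "u m \<in> D n" "w m \<in> D n" using D D_antimono[OF nm] by blast+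
    have eq: "(u m + c *\<^sub>C w m) - (u n + c *\<^sub>C w n) = (u m - u n) + c *\<^sub>C (w m - w n)"
      by (simp add: complex_vector.scale_right_diff_distrib)
    have "energy (b n) ((u m + c *\<^sub>C w m) - (u n + c *\<^sub>C w n)) \<le>
        2 * energy (b n) (u m - u n) + 2 * (cmod c)\<^sup>2 * energy (b n) (w m - w n)"
      unfolding eq by (intro energy_add_scaleC_le[OF b] D_closed[OF angle b] D Dn)
    moreover have "energy (b m) (u m + c *\<^sub>C w m) - energy (b n) (u m + c *\<^sub>C w m) \<le>
        2 * (energy (b m) (u m) - energy (b n) (u m)) +
        2 * (cmod c)\<^sup>2 * (energy (b m) (w m) - energy (b n) (w m))"
      using energy_add_scaleC_le[OF sectorial_form_increment[OF nm] D, of c]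
      by (simp only: energy_increment)
    ultimately show ?thesis by (simp add: oscillation_def distrib_left)
  qed
  fix e :: real assume e: "0 < e"
  \<comment> \<open>\<open>r\<close> is the sum of the two coefficients in \<open>osc\<close>, so
    oscillations up to \<open>e / r\<close> add up to \<open>e\<close>.\<close>
  define r where "r = 2 + 2 * (cmod c)\<^sup>2"
  have r: "0 < r" by (simp add: r_def add_pos_nonneg)
  obtain N where N: "\<forall>n\<ge>N. \<forall>m\<ge>n. oscillation b u n m \<le> e / r"
    using u e r unfolding form_convergent_def by (meson divide_pos_pos)
  obtain N' where N': "\<forall>n\<ge>N'. \<forall>m\<ge>n. oscillation b w n m \<le> e / r"
    using w e r unfolding form_convergent_def by (meson divide_pos_pos)
  have "oscillation b (\<lambda>n. u n + c *\<^sub>C w n) n m \<le> e" if "n \<ge> max N N'" "m \<ge> n" for n m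
  proof -
    have "2 * oscillation b u n m + 2 * (cmod c)\<^sup>2 * oscillation b w n m \<le>
        2 * (e / r) + 2 * (cmod c)\<^sup>2 * (e / r)"
      using N N' that by (intro add_mono mult_left_mono) auto
    also have "\<dots> = r * (e / r)" unfolding r_def by (simp only: distrib_right)
    also have "\<dots> = e" using r by simp
    finally show ?thesis using osc[OF that(2)] by linarith
  qed
  then show "\<exists>N. \<forall>n\<ge>N. \<forall>m\<ge>n. oscillation b (\<lambda>n. u n + c *\<^sub>C w n) n m \<le> e" by blast
qed

text \<open>Comparing \<open>w\<close> at two levels bounds its oscillation by the decrease of its energy plus
  error terms; so the energy is almost decreasing, hence Cauchy, and the oscillation vanishes.\<close>

lemma form_convergent_representer:
  assumes u: "form_convergent D b u" and res: "residual_represented D b F u w"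
    and bdd: "\<forall>\<^sub>F n in sequentially. energy (b n) (w n) \<le> C"
  shows "form_convergent D b w"
proof -
  obtain \<epsilon> where wD: "\<And>n. w n \<in> D n" and eps: "\<epsilon> \<longlonglongrightarrow> 0"
    and r: "\<And>n v. v \<in> D n \<Longrightarrow>
      cmod (hermitian_part (b n) (w n) v - (b n (u n) v - F v)) \<le> \<epsilon> n * sqrt (energy (b n) v)"
    using res by (auto simp: residual_represented_def)
  have uD: "u n \<in> D n" for n using u by (simp add: form_convergent_def)
  define x where "x n = energy (b n) (w n)" for n
  define K where "K = 2 / cos \<theta>"
  have K: "0 < K" using angle by (simp add: K_def cos_gt_zero_pi)
  have x0: "0 \<le> x n" for n unfolding x_def by (rule energy_nonneg[OF angle b wD])
  obtain N0 where N0: "\<And>n. n \<ge> N0 \<Longrightarrow> x n \<le> C"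
    using bdd by (auto simp: eventually_sequentially x_def)
  have C0: "0 \<le> C" using order_trans[OF x0 N0[of N0]] by simp
  \<comment> \<open>Expanding the square, the oscillation of \<open>w\<close> is
    \<open>x m + x n\<close> minus twice the real part of
    \<open>hermitian_part (b n) (w n) (w m)\<close>. Testing the residual equations of levels
    \<open>n\<close> and \<open>m\<close> with the same vector \<open>w m\<close> cancels
    \<open>F\<close> and shows that this real part is \<open>x m\<close> up to the errors.\<close>
  have main: "oscillation b w n m \<le>
      x n - x m + 2 * sqrt C * (\<bar>\<epsilon> n\<bar> + \<bar>\<epsilon> m\<bar>) + 4 * K * sqrt C * sqrt (oscillation b u n m)"
    if n: "N0 \<le> n" and nm: "n \<le> m" for n m
  proof -
    have Dn: "u m \<in> D n" "w m \<in> D n" using uD wD D_antimono[OF nm] by blast+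
    have wm: "sqrt (energy (b m) (w m)) \<le> sqrt C" "sqrt (energy (b n) (w m)) \<le> sqrt C"
      "sqrt (energy (b m) (w m) - energy (b n) (w m)) \<le> sqrt C"
      using N0[of m] n nm energy_mono[OF nm wD] energy_nonneg[OF angle b Dn(2)]
      by (simp_all add: x_def)
    have eps_le: "\<epsilon> k * t \<le> \<bar>\<epsilon> k\<bar> * sqrt C" if "0 \<le> t" "t \<le> sqrt C" for k t
      using that by (intro mult_mono) auto
    define S where "S = sqrt (oscillation b u n m)"
    have S: "sqrt (energy (b n) (u m - u n)) \<le> S" "sqrt (energy (b m) (u m) - energy (b n) (u m)) \<le> S"
      using oscillation_ge[OF uD nm] by (simp_all add: S_def)
    have S0: "0 \<le> S"
      using energy_nonneg[OF angle b D_closed(3)[OF angle b Dn(1) uD]] S(1)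
      by (meson order_trans real_sqrt_ge_zero)
    have "cmod (b n (u m - u n) (w m)) \<le> K * S * sqrt C"
      unfolding K_def
      by (intro order_trans[OF form_le_energy[OF angle b]] D_closed(3)[OF angle b] Dn uD mult_mono S wm
          mult_nonneg_nonneg S0)
        (use K S0 in \<open>auto simp: K_def energy_nonneg[OF angle b] D_closed[OF angle b] Dn uD\<close>)
    \<comment> \<open>The change of form between the levels is controlled by Cauchy-Schwarz for the
      increment; this is the purpose of the second summand of the oscillation of
      \<open>u\<close>.\<close>
    moreover have "cmod (b m (u m) (w m) - b n (u m) (w m)) \<le> K * S * sqrt C"
    proof -
      have "cmod (b m (u m) (w m) - b n (u m) (w m)) \<le> K *
          sqrt (energy (b m) (u m) - energy (b n) (u m)) * sqrt (energy (b m) (w m) - energy (b n) (w m))"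
        using form_le_energy[OF angle sectorial_form_increment[OF nm] uD wD] by (simp add: K_def energy_increment)
      also have "\<dots> \<le> K * S * sqrt C"
        using K S0 energy_mono[OF nm uD] energy_mono[OF nm wD] by (intro mult_mono S wm) auto
      finally show ?thesis .
    qed
    moreover have "cmod (hermitian_part (b n) (w n) (w m) - (b n (u n) (w m) - F (w m))) \<le> \<bar>\<epsilon> n\<bar> * sqrt C"
      by (rule order_trans[OF r[OF Dn(2)]]) (intro eps_le wm real_sqrt_ge_zero energy_nonneg[OF angle b] Dn)
    moreover have "cmod (hermitian_part (b m) (w m) (w m) - (b m (u m) (w m) - F (w m))) \<le> \<bar>\<epsilon> m\<bar> * sqrt C"
      by (rule order_trans[OF r[OF wD]]) (intro eps_le wm real_sqrt_ge_zero energy_nonneg[OF angle b] wD)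
    moreover have "hermitian_part (b m) (w m) (w m) - hermitian_part (b n) (w n) (w m) =
        (hermitian_part (b m) (w m) (w m) - (b m (u m) (w m) - F (w m)))
        - (hermitian_part (b n) (w n) (w m) - (b n (u n) (w m) - F (w m)))
        + (b m (u m) (w m) - b n (u m) (w m)) + b n (u m - u n) (w m)"
      using form_diff_left[OF angle b Dn(1) uD Dn(2)] by simp
    moreover have "cmod (p - q + r + t) \<le> cmod p + cmod q + cmod r + cmod t" for p q r t
      using norm_triangle_ineq[of "p - q + r" t] norm_triangle_ineq[of "p - q" r] norm_triangle_ineq4[of p q]
      by linarith
    ultimately have "cmod (hermitian_part (b m) (w m) (w m) - hermitian_part (b n) (w n) (w m)) \<le>
        \<bar>\<epsilon> m\<bar> * sqrt C + \<bar>\<epsilon> n\<bar> * sqrt C + K * S * sqrt C + K * S * sqrt C"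
      by (smt (verit))
    moreover have "x m - Re (hermitian_part (b n) (w n) (w m)) \<le>
        cmod (hermitian_part (b m) (w m) (w m) - hermitian_part (b n) (w n) (w m))"
      using complex_Re_le_cmod[of "hermitian_part (b m) (w m) (w m) - hermitian_part (b n) (w n) (w m)"]
      by (simp add: hermitian_part_self[OF angle b] x_def)
    moreover have "oscillation b w n m = x m + x n - 2 * Re (hermitian_part (b n) (w n) (w m))"
      unfolding oscillation_def energy_diff[OF angle b Dn(2) wD] by (simp add: x_def)
    ultimately show ?thesis
      unfolding S_def[symmetric] by (simp add: algebra_simps)
  qed
  have err: "\<exists>N\<ge>N0. \<forall>n\<ge>N. \<forall>m\<ge>n.
      2 * sqrt C * (\<bar>\<epsilon> n\<bar> + \<bar>\<epsilon> m\<bar>) + 4 * K * sqrt C * sqrt (oscillation b u n m) \<le> e"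
    if e: "0 < e" for e
  proof -
    \<comment> \<open>With \<open>\<bar>\<epsilon>\<bar>\<close> and the root of the oscillation at
      most \<open>d\<close>, the error is \<open>d\<close> times the first two terms of the
      denominator; the 1 keeps it positive if \<open>C = 0\<close>.\<close>
    define d where "d = e / (4 * sqrt C + 4 * K * sqrt C + 1)"
    have den: "0 < 4 * sqrt C + 4 * K * sqrt C + 1" using C0 K by (simp add: add_nonneg_pos)
    then have d: "0 < d" using e by (simp add: d_def)
    obtain N1 where N1: "\<And>n. n \<ge> N1 \<Longrightarrow> \<bar>\<epsilon> n\<bar> < d"
      using eps d unfolding LIMSEQ_iff by auto
    obtain N2 where N2: "\<And>n m. n \<ge> N2 \<Longrightarrow> m \<ge> n \<Longrightarrow> oscillation b u n m \<le> d\<^sup>2"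
      using u d unfolding form_convergent_def by (meson zero_less_power)
    have "2 * sqrt C * (\<bar>\<epsilon> n\<bar> + \<bar>\<epsilon> m\<bar>) + 4 * K * sqrt C * sqrt (oscillation b u n m) \<le> e"
      if "n \<ge> max N0 (max N1 N2)" "m \<ge> n" for n m
    proof -
      have "sqrt (oscillation b u n m) \<le> d"
        using N2[of n m] that d by (intro real_le_lsqrt) auto
      moreover have "\<bar>\<epsilon> n\<bar> + \<bar>\<epsilon> m\<bar> \<le> d + d"
        using less_imp_le[OF N1[of n]] less_imp_le[OF N1[of m]] that by (intro add_mono) auto
      ultimately have "2 * sqrt C * (\<bar>\<epsilon> n\<bar> + \<bar>\<epsilon> m\<bar>) + 4 * K * sqrt C * sqrt (oscillation b u n m) \<le>
          2 * sqrt C * (d + d) + 4 * K * sqrt C * d"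
        using K C0 by (intro add_mono[of "2 * sqrt C * _"] mult_left_mono) auto
      also have "\<dots> \<le> d * (4 * sqrt C + 4 * K * sqrt C + 1)" using d by (simp add: algebra_simps)
      also have "\<dots> = e" using den by (simp add: d_def)
      finally show ?thesis .
    qed
    then show ?thesis by (intro exI[of _ "max N0 (max N1 N2)"]) auto
  qed
  have osc0: "0 \<le> oscillation b w n m" if "n \<le> m" for n m
    using energy_nonneg[OF angle b D_closed(3)[OF angle b _ wD]] D_antimono[OF that] wD
      oscillation_ge(1)[OF wD that] by (meson order_trans subsetD)
  have "\<exists>N. \<forall>n\<ge>N. \<forall>m\<ge>n. x m \<le> x n + e" if e: "0 < e" for e
  proof -
    obtain N where N: "N \<ge> N0" "\<And>n m. n \<ge> N \<Longrightarrow> m \<ge> n \<Longrightarrow>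
        2 * sqrt C * (\<bar>\<epsilon> n\<bar> + \<bar>\<epsilon> m\<bar>) + 4 * K * sqrt C * sqrt (oscillation b u n m) \<le> e"
      using err[OF e] by auto
    have "x m \<le> x n + e" if "n \<ge> N" "m \<ge> n" for n m
    proof -
      have "N0 \<le> n" using N(1) that by linarith
      from main[OF this that(2)] osc0[OF that(2)] N(2)[OF that] show ?thesis by linarith
    qed
    then show ?thesis by blast
  qed
  note Cauchy = almost_decreasing_Cauchy[OF x0 this]
  have "\<exists>N. \<forall>n\<ge>N. \<forall>m\<ge>n. oscillation b w n m \<le> e" if e: "0 < e" for e
  proof -
    obtain N1 where N1: "N1 \<ge> N0" "\<And>n m. n \<ge> N1 \<Longrightarrow> m \<ge> n \<Longrightarrow>
        2 * sqrt C * (\<bar>\<epsilon> n\<bar> + \<bar>\<epsilon> m\<bar>) + 4 * K * sqrt C * sqrt (oscillation b u n m) \<le> e / 2"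
      using err[of "e / 2"] e by auto
    obtain N2 where N2: "\<And>n m. n \<ge> N2 \<Longrightarrow> m \<ge> n \<Longrightarrow> x n - x m \<le> e / 2"
      using Cauchy[of "e / 2"] e by auto
    have "oscillation b w n m \<le> e" if "n \<ge> max N1 N2" "m \<ge> n" for n m
      using main[of n m] N1(1) N1(2)[of n m] N2[of n m] that by simp
    then show ?thesis by blast
  qed
  then show ?thesis
    unfolding form_convergent_def using wD bdd by (intro conjI exI[of _ C]) auto
qed

section \<open>Richardson iteration for a functional that is antilinear and bounded uniformly in the
  level\<close>

context
  fixes F :: "'a \<Rightarrow> complex" and M :: real
  assumes F_add: "\<And>u v. F (u + v) = F u + F v"
    and F_scale: "\<And>c u. F (c *\<^sub>C u) = cnj c * F u"
    and F_bound: "\<And>n u. u \<in> D n \<Longrightarrow> cmod (F u) \<le> M * sqrt (energy (b n) u)"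
    and M_nonneg: "0 \<le> M"
begin

text \<open>The iteration starts at 0, where the residual is \<open>- F\<close>. The tolerance at
  level \<open>n\<close> is at most 1, whence the bound \<open>M + 1\<close>.\<close>

lemma solvable_upto_initial: "solvable_upto D b F ((M + 1)\<^sup>2)"
proof -
  have bound: "cmod (- F u) \<le> M * sqrt (energy (b n) u)" if "u \<in> D n" for u n
    using F_bound[OF that] by simp
  define P where "P n w \<longleftrightarrow> w \<in> D n \<and> (\<forall>v\<in>D n. cmod (hermitian_part (b n) w v - (- F v)) \<le>
      inverse (real (Suc n)) * sqrt (energy (b n) v)) \<and>
      sqrt (energy (b n) w) \<le> M + inverse (real (Suc n))" for n w
  have "\<exists>w. P n w" for n
    by (rule approximate_Riesz[OF angle b[of n], of "\<lambda>v. - F v" M "inverse (real (Suc n))"])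
      (use bound in \<open>auto simp: P_def F_add F_scale M_nonneg\<close>)
  then obtain w where w: "\<And>n. P n (w n)" by metis
  have zero: "b n 0 v = 0" if "v \<in> D n" for n v
    by (rule form_zero_left[OF angle b that])
  have "form_convergent D b (\<lambda>_. 0)"
    by (auto simp: form_convergent_def oscillation_def energy_def zero D_closed(1)[OF angle b])
  moreover have "residual_represented D b F (\<lambda>_. 0) w"
    unfolding residual_represented_def
    using w by (intro conjI exI[of _ "\<lambda>n. inverse (real (Suc n))"] LIMSEQ_inverse_real_of_nat)
      (auto simp: P_def zero)
  moreover have "energy (b n) (w n) \<le> (M + 1)\<^sup>2" for n
  proof -
    have "inverse (real (Suc n)) \<le> 1" by (simp add: field_simps)
    then have "sqrt (energy (b n) (w n)) \<le> M + 1" using w[of n] unfolding P_def by linarith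
    then show ?thesis by (rule sqrt_le_D)
  qed
  ultimately show ?thesis unfolding solvable_upto_def by (blast intro: always_eventually)
qed

text \<open>One Richardson step \<open>u \<mapsto> u - \<rho> w\<close>: with \<open>z\<close> representing \<open>b w\<close>, the new residual
  \<open>w - \<rho> z\<close> satisfies \<open>energy (w - \<rho> z) \<le> (1 - 2 \<rho> + \<rho>\<^sup>2 K\<^sup>2) energy w\<close> up to errors, where \<open>K\<close> is the
  bound of \<open>b\<close>.\<close>

lemma solvable_upto_step:
  assumes s: "0 < s" and sol: "solvable_upto D b F s"
  shows "solvable_upto D b F ((1 - (cos \<theta>)\<^sup>2 / 8) * s)"
proof -
  define K where "K = 2 / cos \<theta>"
  have cos: "0 < cos \<theta>" using angle by (simp add: cos_gt_zero_pi)
  have K: "0 < K" using cos by (simp add: K_def)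
  \<comment> \<open>This is \<open>1 / K\<^sup>2\<close>, the minimizer of
    \<open>1 - 2 \<rho> + \<rho>\<^sup>2 K\<^sup>2\<close>, with minimum \<open>1 - \<rho>\<close>.
    The claimed factor is \<open>1 - \<rho> / 2\<close>; the other half absorbs the errors.\<close>
  define \<rho> where "\<rho> = (cos \<theta>)\<^sup>2 / 4"
  have rho: "0 < \<rho>" "\<rho> < 1" "\<rho>\<^sup>2 * K\<^sup>2 = \<rho>"
    using cos abs_square_le_1[of "cos \<theta>"]
    by (simp_all add: \<rho>_def K_def power2_eq_square)
  obtain u w \<epsilon> where u: "form_convergent D b u" and wD: "\<And>n. w n \<in> D n" and eps: "\<epsilon> \<longlonglongrightarrow> 0"
    and r: "\<And>n v. v \<in> D n \<Longrightarrow>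
      cmod (hermitian_part (b n) (w n) v - (b n (u n) v - F v)) \<le> \<epsilon> n * sqrt (energy (b n) v)"
    and res: "residual_represented D b F u w"
    and ws: "\<forall>\<^sub>F n in sequentially. energy (b n) (w n) \<le> s"
    using sol unfolding solvable_upto_def residual_represented_def by blast
  have uD: "u n \<in> D n" for n using u by (simp add: form_convergent_def)
  define d where "d n = inverse (real (Suc n))" for n
  have d0: "0 < d n" for n by (simp add: d_def)
  have d: "d \<longlonglongrightarrow> 0" unfolding d_def by (rule LIMSEQ_inverse_real_of_nat)
  define N where "N n = sqrt (energy (b n) (w n))" for n
  have N0: "0 \<le> N n" and N2: "(N n)\<^sup>2 = energy (b n) (w n)" for n
    using energy_nonneg[OF angle b wD] by (simp_all add: N_def)
  define P where "P n z \<longleftrightarrow> z \<in> D n \<and>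
      (\<forall>v\<in>D n. cmod (hermitian_part (b n) z v - b n (w n) v) \<le> d n * sqrt (energy (b n) v)) \<and>
      sqrt (energy (b n) z) \<le> K * N n + d n" for n z
  have KN: "0 \<le> K * N n" "\<And>v. v \<in> D n \<Longrightarrow> cmod (b n (w n) v) \<le> K * N n * sqrt (energy (b n) v)" for n
    unfolding N_def using K energy_nonneg[OF angle b wD] form_le_energy[OF angle b wD] by (simp_all add: K_def)
  have "\<exists>z. P n z" for n
    by (rule approximate_Riesz[OF angle b[of n], of "b n (w n)" "K * N n" "d n"])
      (auto simp: P_def form_add_right[OF angle b] form_scaleC_right[OF angle b] wD d0 KN)
  then obtain z where z: "\<And>n. P n (z n)" by metis
  have zD: "z n \<in> D n" for n using z[of n] by (simp add: P_def)
  have zr: "cmod (hermitian_part (b n) (z n) v - b n (w n) v) \<le> d n * sqrt (energy (b n) v)"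
    if "v \<in> D n" for n v using z[of n] that by (simp add: P_def)
  define c where "c = complex_of_real (- \<rho>)"
  have c: "cmod c = \<rho>" using rho by (simp add: c_def)
  have "form_convergent D b (\<lambda>n. u n + c *\<^sub>C w n)"
    by (intro form_convergent_add_scaleC form_convergent_representer[OF u res ws] u)
  moreover have "residual_represented D b F (\<lambda>n. u n + c *\<^sub>C w n) (\<lambda>n. w n + c *\<^sub>C z n)"
    unfolding residual_represented_def
  proof (intro conjI allI ballI exI[of _ "\<lambda>n. \<epsilon> n + \<rho> * d n"])
    show "w n + c *\<^sub>C z n \<in> D n" for n
      by (intro D_closed[OF angle b] wD zD)
    show "(\<lambda>n. \<epsilon> n + \<rho> * d n) \<longlonglongrightarrow> 0"
      using tendsto_add[OF eps tendsto_mult[OF tendsto_const d, of \<rho>]] by simp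
    fix n v assume v: "v \<in> D n"
    have "hermitian_part (b n) (w n + c *\<^sub>C z n) v - (b n (u n + c *\<^sub>C w n) v - F v) =
        (hermitian_part (b n) (w n) v - (b n (u n) v - F v)) +
        c * (hermitian_part (b n) (z n) v - b n (w n) v)"
      using v uD wD zD by (simp add: hermitian_part_add_scaleC_left[OF angle b] form_add_left[OF angle b]
          form_scaleC_left[OF angle b] D_closed[OF angle b] algebra_simps)
    also have "cmod \<dots> \<le> \<epsilon> n * sqrt (energy (b n) v) + \<rho> * (d n * sqrt (energy (b n) v))"
      using rho by (intro order_trans[OF norm_triangle_ineq] add_mono r v)
        (auto simp: norm_mult c intro!: zr v)
    finally show "cmod (hermitian_part (b n) (w n + c *\<^sub>C z n) v - (b n (u n + c *\<^sub>C w n) v - F v)) \<le>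
        (\<epsilon> n + \<rho> * d n) * sqrt (energy (b n) v)"
      by (simp add: algebra_simps)
  qed
  moreover have "\<forall>\<^sub>F n in sequentially. energy (b n) (w n + c *\<^sub>C z n) \<le> (1 - (cos \<theta>)\<^sup>2 / 8) * s"
  proof -
    have est: "energy (b n) (w n + c *\<^sub>C z n) \<le>
        (1 - \<rho>) * (N n)\<^sup>2 + d n * (2 * \<rho> * N n + \<rho>\<^sup>2 * (2 * K * N n + d n))" for n
    proof -
      have "Re (hermitian_part (b n) (w n) (z n)) = Re (hermitian_part (b n) (z n) (w n))"
        by (simp add: hermitian_part_def)
      \<comment> \<open>Since \<open>z n\<close> represents \<open>b n (w n)\<close>, testing with
        \<open>w n\<close> turns the cross term into the energy of \<open>w n\<close>, up to
        \<open>d n\<close>.\<close>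
      moreover have *: "(N n)\<^sup>2 - Re (hermitian_part (b n) (z n) (w n)) \<le> d n * N n"
        using order_trans[OF abs_Re_le_cmod zr[OF wD, of n]] unfolding N2
        by (simp add: N_def energy_def abs_le_iff)
      ultimately have "- 2 * \<rho> * Re (hermitian_part (b n) (w n) (z n)) \<le> 2 * \<rho> * (d n * N n - (N n)\<^sup>2)"
        using mult_left_mono[OF *, of "2 * \<rho>"] rho by (simp add: algebra_simps)
      moreover have "energy (b n) (z n) \<le> (K * N n + d n)\<^sup>2"
        using z[of n] unfolding P_def by (intro sqrt_le_D) blast
      then have "\<rho>\<^sup>2 * energy (b n) (z n) \<le> \<rho>\<^sup>2 * (K * N n + d n)\<^sup>2"
        by (intro mult_left_mono) auto
      moreover have "energy (b n) (w n + c *\<^sub>C z n) =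
          (N n)\<^sup>2 + - 2 * \<rho> * Re (hermitian_part (b n) (w n) (z n)) + \<rho>\<^sup>2 * energy (b n) (z n)"
        unfolding energy_add_scaleC[OF angle b wD zD] c N2 by (simp add: c_def)
      moreover have "\<rho>\<^sup>2 * (K * N n + d n)\<^sup>2 = (\<rho>\<^sup>2 * K\<^sup>2) * (N n)\<^sup>2 + \<rho>\<^sup>2 * (d n * (2 * K * N n + d n))"
        by (simp add: power2_eq_square algebra_simps)
      ultimately show ?thesis unfolding rho(3) by (simp add: algebra_simps)
    qed
    \<comment> \<open>Replacing \<open>N n\<close> by its eventual bound \<open>sqrt s\<close>
      leaves error terms that tend to 0. As \<open>0 < s\<close>, the limit lies strictly below the
      claimed bound, so the bound holds eventually.\<close>
    let ?B = "\<lambda>n. (1 - \<rho>) * s + d n * (2 * \<rho> * sqrt s + \<rho>\<^sup>2 * (2 * K * sqrt s + d n))"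
    have "?B \<longlonglongrightarrow> (1 - \<rho>) * s + 0 * (2 * \<rho> * sqrt s + \<rho>\<^sup>2 * (2 * K * sqrt s + 0))"
      by (intro tendsto_intros d)
    moreover have "(1 - \<rho>) * s + 0 * (2 * \<rho> * sqrt s + \<rho>\<^sup>2 * (2 * K * sqrt s + 0)) < (1 - \<rho> / 2) * s"
      using rho s by simp
    ultimately have "\<forall>\<^sub>F n in sequentially. ?B n < (1 - \<rho> / 2) * s"
      by (rule order_tendstoD(2))
    with ws show ?thesis
    proof eventually_elim
      case (elim n)
      have Ns: "N n \<le> sqrt s" using elim(1) by (simp add: N_def)
      have "(1 - \<rho>) * (N n)\<^sup>2 + d n * (2 * \<rho> * N n + \<rho>\<^sup>2 * (2 * K * N n + d n)) \<le> ?B n"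
        using rho K less_imp_le[OF d0[of n]] elim(1)
        by (intro add_mono mult_left_mono Ns order_refl) (auto simp: N2)
      then show ?case using est[of n] elim(2) by (simp add: \<rho>_def)
    qed
  qed
  ultimately show ?thesis unfolding solvable_upto_def by blast
qed

text \<open>The factor is below 1 and the same in every step, so finitely many steps from the
  initial bound reach any positive \<open>s\<close>.\<close>

lemma solvable_upto_any:
  assumes s: "0 < s"
  shows "solvable_upto D b F s"
proof -
  define q where "q = 1 - (cos \<theta>)\<^sup>2 / 8"
  have cos: "0 < cos \<theta>" using angle by (simp add: cos_gt_zero_pi)
  have q: "0 < q" "q < 1"
    using cos abs_square_le_1[of "cos \<theta>"] by (simp_all add: q_def)
  have M: "0 < (M + 1)\<^sup>2" using M_nonneg by simp
  have "solvable_upto D b F (q ^ k * (M + 1)\<^sup>2)" for k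
  proof (induction k)
    case 0
    then show ?case using solvable_upto_initial by simp
  next
    case (Suc k)
    have "0 < q ^ k * (M + 1)\<^sup>2" using q M by simp
    from solvable_upto_step[OF this Suc.IH] show ?case by (simp add: q_def mult.assoc)
  qed
  moreover obtain k where "q ^ k < s / (M + 1)\<^sup>2"
    using real_arch_pow_inv[of "s / (M + 1)\<^sup>2" q] q s M by auto
  then have "q ^ k * (M + 1)\<^sup>2 \<le> s" using M by (simp add: field_simps)
  ultimately show ?thesis using solvable_upto_mono by blast
qed

end

end

section \<open>The resolvent of the associated relation\<close>

text \<open>The energy of the shifted form is the square of \<open>form_norm\<close>, and the
  resolvent equation \<open>a x = cinner (f - x)\<close> becomes
  \<open>shifted a x = cinner f\<close>.\<close>

definition shifted :: "('a::complex_hilbert_space \<Rightarrow> 'a \<Rightarrow> complex) \<Rightarrow> 'a \<Rightarrow> 'a \<Rightarrow> complex" where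
  "shifted q u v = q u v + cinner u v"

context
  fixes \<theta> :: real and D :: "'a::complex_hilbert_space set" and a :: "'a \<Rightarrow> 'a \<Rightarrow> complex"
  assumes angle: "0 \<le> \<theta>" "\<theta> < pi / 2" and a: "sectorial_form \<theta> D a"
begin

lemma sectorial_form_shifted: "sectorial_form \<theta> D (shifted a)"
proof -
  have "sectorial_form \<theta> D cinner"
    using sectorial_form_subset[OF sectorial_form_cinner[OF angle]] a by (auto simp: sectorial_form_def)
  from sectorial_form_add[OF angle a this] show ?thesis
    by (simp add: shifted_def[abs_def])
qed

lemma sqrt_energy_shifted: "sqrt (energy (shifted a) u) = form_norm a u"
  by (simp add: energy_def shifted_def form_norm_def power2_norm_eq_cinner)

lemma cinner_le_form_norm: "v \<in> D \<Longrightarrow> cmod (cinner f v) \<le> 2 * norm f * form_norm a v"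
  by (rule order_trans[OF norm_cinner_le mult_left_mono[OF norm_le_form_norm[OF angle a]]]) auto

text \<open>A single form is a constant sequence with zero increments, so the iteration applies to
  it and plays the role of the Lax-Milgram theorem.\<close>

lemma approximate_solution_exists:
  assumes e: "0 < e"
  obtains y where "y \<in> D" "\<And>v. v \<in> D \<Longrightarrow> cmod (shifted a y v - cinner f v) \<le> e * form_norm a v"
proof -
  note b = sectorial_form_shifted
  have "sectorial_form \<theta> D (\<lambda>u v. shifted a u v - shifted a u v)"
    using b by (simp add: sectorial_form_iff[OF angle] sesquilinear_on_def energy_def)
  define K where "K = 2 / cos \<theta>"
  have K: "0 < K" using angle by (simp add: K_def cos_gt_zero_pi)
  \<comment> \<open>Half of \<open>e\<close> pays for the Hermitian part of the representative,
    bounded by \<open>K\<close> times the root of its energy, the other half for the representation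
    error.\<close>
  have "solvable_upto (\<lambda>_. D) (\<lambda>_. shifted a) (cinner f) ((e / 2 / K)\<^sup>2)"
    by (rule solvable_upto_any[OF angle, where M = "2 * norm f"])
      (use b \<open>sectorial_form \<theta> D (\<lambda>u v. shifted a u v - shifted a u v)\<close> e K in
        \<open>auto simp: cinner_add_right cinner_scaleC_right cinner_le_form_norm sqrt_energy_shifted\<close>)
  then obtain u w \<epsilon> where u: "\<And>n. u n \<in> D" and w: "\<And>n. w n \<in> D" and eps: "\<epsilon> \<longlonglongrightarrow> 0"
    and r: "\<And>n v. v \<in> D \<Longrightarrow>
      cmod (hermitian_part (shifted a) (w n) v - (shifted a (u n) v - cinner f v)) \<le> \<epsilon> n * form_norm a v"
    and s: "\<forall>\<^sub>F n in sequentially. energy (shifted a) (w n) \<le> (e / 2 / K)\<^sup>2"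
    unfolding solvable_upto_def residual_represented_def form_convergent_def sqrt_energy_shifted by blast
  have "\<forall>\<^sub>F n in sequentially. \<epsilon> n < e / 2"
    using order_tendstoD(2)[OF eps, of "e / 2"] e by simp
  with s have "\<forall>\<^sub>F n in sequentially. energy (shifted a) (w n) \<le> (e / 2 / K)\<^sup>2 \<and> \<epsilon> n < e / 2"
    by (rule eventually_conj)
  then obtain n where n: "energy (shifted a) (w n) \<le> (e / 2 / K)\<^sup>2" "\<epsilon> n < e / 2"
    by (auto simp: eventually_sequentially)
  have "cmod (shifted a (u n) v - cinner f v) \<le> e * form_norm a v" if v: "v \<in> D" for v
  proof -
    define g where "g = shifted a (u n) v - cinner f v"
    define h where "h = hermitian_part (shifted a) (w n) v"
    have N: "0 \<le> form_norm a v" by (rule form_norm_nonneg[OF angle a v])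
    have "sqrt (energy (shifted a) (w n)) \<le> e / 2 / K"
      using n(1) e K by (intro real_le_lsqrt) auto
    then have "K * sqrt (energy (shifted a) (w n)) \<le> e / 2"
      using K by (simp add: field_simps)
    moreover have "cmod h \<le> K * sqrt (energy (shifted a) (w n)) * form_norm a v"
      using hermitian_part_le_energy[OF angle b w v] unfolding K_def h_def sqrt_energy_shifted .
    ultimately have "cmod h \<le> e / 2 * form_norm a v"
      using mult_right_mono[OF _ N] by (meson order_trans)
    moreover have "cmod (h - g) \<le> e / 2 * form_norm a v"
      using order_trans[OF r[OF v] mult_right_mono[OF less_imp_le[OF n(2)] N]]
      unfolding h_def g_def .
    ultimately have "cmod g \<le> e * form_norm a v"
      using norm_triangle_ineq4[of h "h - g"] by simp
    then show ?thesis by (simp add: g_def)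
  qed
  then show ?thesis using that[of "u n"] u by blast
qed

text \<open>Approximate solutions with tolerances tending to 0 form a Cauchy sequence, and its class
  in the completion solves the equation exactly. The lemmas after this one use such sequences and no
  longer touch the completion.\<close>

lemma associated_relation_approximation:
  obtains y where "form_Cauchy D a y" "y \<longlonglongrightarrow> resolvent (associated_relation D a) f"
    "\<And>k v. v \<in> D \<Longrightarrow> cmod (shifted a (y k) v - cinner f v) \<le> inverse (real (Suc k)) * form_norm a v"
    "\<And>w z. form_Cauchy D a w \<Longrightarrow> w \<longlonglongrightarrow> z \<Longrightarrow>
      (\<lambda>k. a (y k) (w k)) \<longlonglongrightarrow> cinner (f - resolvent (associated_relation D a) f) z"
proof -
  note b = sectorial_form_shifted
  have "\<exists>y\<in>D. \<forall>v\<in>D. cmod (shifted a y v - cinner f v) \<le> inverse (real (Suc k)) * form_norm a v" for k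
    by (rule approximate_solution_exists[of "inverse (real (Suc k))" f]) auto
  then obtain y where yD: "\<And>k. y k \<in> D"
    and y: "\<And>k v. v \<in> D \<Longrightarrow> cmod (shifted a (y k) v - cinner f v) \<le> inverse (real (Suc k)) * form_norm a v"
    by metis
  have zero: "hermitian_part (shifted a) 0 v = 0" "energy (shifted a) 0 = 0" if "v \<in> D" for v
    using that D_closed(1)[OF angle b]
    by (simp_all add: hermitian_part_def energy_def form_zero_left[OF angle b] form_zero_right[OF angle b])
  \<comment> \<open>The representative is 0 here: \<open>y l\<close> is itself an approximate
    solution.\<close>
  have near: "form_norm a (y k - y l) \<le> inverse (real (Suc k)) + inverse (real (Suc l))" for k l
    using approximate_solution_unique[OF angle b yD yD D_closed(1)[OF angle b], of "inverse (real (Suc k))"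
        "inverse (real (Suc l))" k "cinner f" l] y
    by (simp add: sqrt_energy_shifted zero[OF yD] zero norm_minus_commute)
  have Cy: "form_Cauchy D a y"
    unfolding form_Cauchy_def
  proof (intro conjI allI impI yD)
    fix e :: real assume "0 < e"
    then obtain N where N: "inverse (real (Suc N)) < e / 2"
      using reals_Archimedean[of "e / 2"] by auto
    have "form_norm a (y k - y l) < e" if "k \<ge> N" "l \<ge> N" for k l
    proof -
      have "inverse (real (Suc k)) \<le> inverse (real (Suc N))" "inverse (real (Suc l)) \<le> inverse (real (Suc N))"
        using that by (simp_all add: field_simps)
      then show ?thesis using near[of k l] N by linarith
    qed
    then show "\<exists>N. \<forall>m\<ge>N. \<forall>n\<ge>N. form_norm a (y m - y n) < e" by blast
  qed
  obtain x where x: "y \<longlonglongrightarrow> x"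
    using form_Cauchy_imp_Cauchy[OF angle a Cy] by (auto simp: Cauchy_convergent_iff convergent_def)
  \<comment> \<open>Along \<open>w\<close> of bounded form norm the residual of the shifted form
    tends to 0; removing the inner product, which converges in the Hilbert space, leaves the
    equation for \<open>a\<close>.\<close>
  have lim: "(\<lambda>k. a (y k) (w k)) \<longlonglongrightarrow> cinner (f - x) z" if w: "form_Cauchy D a w" "w \<longlonglongrightarrow> z" for w z
  proof -
    have wD: "w k \<in> D" for k using w by (simp add: form_Cauchy_def)
    obtain B where B: "0 < B" "\<And>k. form_norm a (w k) \<le> B"
      using form_Cauchy_bounded[OF angle a w(1)] by blast
    have le: "cmod (shifted a (y k) (w k) - cinner f (w k)) \<le> inverse (real (Suc k)) * B" for k
      by (rule order_trans[OF y[OF wD] mult_left_mono[OF B(2)]]) simp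
    have "(\<lambda>k. inverse (real (Suc k)) * B) \<longlonglongrightarrow> 0"
      using tendsto_mult[OF LIMSEQ_inverse_real_of_nat tendsto_const, of B] by simp
    then have "(\<lambda>k. shifted a (y k) (w k) - cinner f (w k)) \<longlonglongrightarrow> 0"
      by (rule Lim_null_comparison[OF always_eventually[OF allI[OF le]]])
    then have "(\<lambda>k. (shifted a (y k) (w k) - cinner f (w k)) + (cinner f (w k) - cinner (y k) (w k)))
        \<longlonglongrightarrow> 0 + (cinner f z - cinner x z)"
      by (intro tendsto_intros tendsto_cinner x w)
    then show ?thesis
      by (simp add: shifted_def bounded_bilinear.diff_left[OF bounded_bilinear_cinner])
  qed
  note equiv = equiv_form_equiv[OF angle a]
  define U where "U = form_equiv D a `` {y}"
  have U: "U \<in> form_completion D a" "y \<in> U"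
    using Cy equiv_class_self[OF equiv] by (auto simp: U_def form_completion_def intro: quotientI)
  have map: "completion_map V = z" if "V \<in> form_completion D a" "v \<in> V" "v \<longlonglongrightarrow> z" for V v z
    using completion_map_tendsto[OF angle a that(1,2)] that(3) by (rule LIMSEQ_unique)
  have "resolvent (associated_relation D a) f = x"
    unfolding resolvent_def
  proof (rule the_equality)
    have "completion_form a U W = cinner (f - x) (completion_map W)" if W: "W \<in> form_completion D a" for W
    proof -
      obtain w where w: "w \<in> W" using form_completionD(1)[OF angle a W] by blast
      show ?thesis
        using completion_form_tendsto[OF angle a U(1) W U(2) w]
          lim[OF form_completionD(2)[OF angle a W w] completion_map_tendsto[OF angle a W w]]
        by (rule LIMSEQ_unique)
    qed
    then have "(x, f - x) \<in> associated_relation D a"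
      unfolding associated_relation_def using U(1) map[OF U x] by blast
    then show "(f, x) \<in> (id_plus_rel (associated_relation D a))\<inverse>"
      by (force simp: id_plus_rel_def)
  next
    fix x' assume "(f, x') \<in> (id_plus_rel (associated_relation D a))\<inverse>"
    then obtain g where g: "f = x' + g" "(x', g) \<in> associated_relation D a"
      by (auto simp: id_plus_rel_def)
    then obtain V where V: "V \<in> form_completion D a" "completion_map V = x'"
      and sol: "\<And>W. W \<in> form_completion D a \<Longrightarrow> completion_form a V W = cinner (f - x') (completion_map W)"
      by (auto simp: associated_relation_def)
    obtain v where v: "v \<in> V" using form_completionD(1)[OF angle a V(1)] by blast
    have Cv: "form_Cauchy D a v" by (rule form_completionD(2)[OF angle a V(1) v])
    have vx: "v \<longlonglongrightarrow> x'" using completion_map_tendsto[OF angle a V(1) v] V(2) by simp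
    have vD: "v k \<in> D" for k using Cv by (simp add: form_Cauchy_def)
    \<comment> \<open>Uniqueness: the four terms of \<open>a (v k - y k) (v k - y k)\<close> have
      known limits, which combine to minus the squared norm of \<open>x' - x\<close>. The real part
      is nonnegative, so \<open>x' = x\<close>.\<close>
    have "(\<lambda>k. (a (v k) (v k) - a (v k) (y k)) - (a (y k) (v k) - a (y k) (y k))) \<longlonglongrightarrow>
        (cinner (f - x') x' - cinner (f - x') x) - (cinner (f - x) x' - cinner (f - x) x)"
      using completion_form_tendsto[OF angle a V(1) V(1) v v] completion_form_tendsto[OF angle a V(1) U(1) v U(2)]
      by (intro tendsto_diff lim[OF Cy x] lim[OF Cv vx]) (simp_all add: sol V U map[OF U x])
    also have "(\<lambda>k. (a (v k) (v k) - a (v k) (y k)) - (a (y k) (v k) - a (y k) (y k))) =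
        (\<lambda>k. a (v k - y k) (v k - y k))"
      using vD yD by (simp add: form_diff_left[OF angle a] form_diff_right[OF angle a]
          form_dom_closed[OF angle a] algebra_simps)
    also have "(cinner (f - x') x' - cinner (f - x') x) - (cinner (f - x) x' - cinner (f - x) x) =
        - cinner (x' - x) (x' - x)"
      by (simp add: bounded_bilinear.diff_left[OF bounded_bilinear_cinner]
          bounded_bilinear.diff_right[OF bounded_bilinear_cinner])
    finally have "(\<lambda>k. Re (a (v k - y k) (v k - y k))) \<longlonglongrightarrow> Re (- cinner (x' - x) (x' - x))"
      by (rule tendsto_Re)
    then have "0 \<le> Re (- cinner (x' - x) (x' - x))"
      by (rule LIMSEQ_le_const)
        (use vD yD in \<open>auto intro!: form_Re_nonneg[OF angle a] form_dom_closed[OF angle a]\<close>)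
    then show "x' = x" by (simp add: cinner_self)
  qed
  then show ?thesis using that[of y] Cy x y lim by simp
qed

text \<open>The form norm dominates the norm, so \<open>approximate_solution_unique\<close> passes
  to the limit along approximate solutions. Thus a small representative of the residual puts
  \<open>u\<close> close to the resolvent.\<close>

lemma resolvent_near:
  assumes "u \<in> D" "w \<in> D" "0 \<le> e"
    and "\<And>v. v \<in> D \<Longrightarrow> cmod (hermitian_part (shifted a) w v - (shifted a u v - cinner f v)) \<le> e * form_norm a v"
  shows "norm (resolvent (associated_relation D a) f - u) \<le> 2 / cos \<theta> * sqrt (energy (shifted a) w) + e"
proof -
  note b = sectorial_form_shifted
  obtain y where Cy: "form_Cauchy D a y" and x: "y \<longlonglongrightarrow> resolvent (associated_relation D a) f"
    and y: "\<And>k v. v \<in> D \<Longrightarrow> cmod (shifted a (y k) v - cinner f v) \<le> inverse (real (Suc k)) * form_norm a v"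
    by (rule associated_relation_approximation[of f]) blast
  have yD: "y k \<in> D" for k using Cy by (simp add: form_Cauchy_def)
  have "norm (y k - u) \<le> 2 / cos \<theta> * sqrt (energy (shifted a) w) + inverse (real (Suc k)) + e" for k
  proof -
    have "norm (y k - u) \<le> sqrt (energy (shifted a) (y k - u))"
      unfolding sqrt_energy_shifted
      by (intro norm_le_form_norm[OF angle a] form_dom_closed[OF angle a] yD assms)
    also have "\<dots> \<le> 2 / cos \<theta> * sqrt (energy (shifted a) w) + inverse (real (Suc k)) + e"
      by (rule approximate_solution_unique[OF angle b yD assms(1,2), where F = "cinner f"])
        (use y assms in \<open>auto simp: sqrt_energy_shifted\<close>)
    finally show ?thesis .
  qed
  moreover have "(\<lambda>k. norm (y k - u)) \<longlonglongrightarrow> norm (resolvent (associated_relation D a) f - u)"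
    by (intro tendsto_intros x)
  moreover have "(\<lambda>k. 2 / cos \<theta> * sqrt (energy (shifted a) w) + inverse (real (Suc k)) + e) \<longlonglongrightarrow>
      2 / cos \<theta> * sqrt (energy (shifted a) w) + 0 + e"
    by (intro tendsto_add tendsto_const LIMSEQ_inverse_real_of_nat)
  ultimately show ?thesis
    by (auto dest: LIMSEQ_le)
qed

text \<open>The combination of approximate solutions for \<open>f\<close> and \<open>g\<close> is
  one for \<open>f + c *\<^sub>C g\<close>, with tolerance enlarged by \<open>1 + cmod c\<close>;
  \<open>resolvent_near\<close> with representative 0 identifies its limit.\<close>

lemma resolvent_add_scaleC:
  "resolvent (associated_relation D a) (f + c *\<^sub>C g) =
    resolvent (associated_relation D a) f + c *\<^sub>C resolvent (associated_relation D a) g"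
proof -
  note b = sectorial_form_shifted
  let ?R = "resolvent (associated_relation D a)"
  obtain y where Cy: "form_Cauchy D a y" and yx: "y \<longlonglongrightarrow> ?R f"
    and y: "\<And>k v. v \<in> D \<Longrightarrow> cmod (shifted a (y k) v - cinner f v) \<le> inverse (real (Suc k)) * form_norm a v"
    by (rule associated_relation_approximation[of f]) blast
  obtain z where Cz: "form_Cauchy D a z" and zx: "z \<longlonglongrightarrow> ?R g"
    and z: "\<And>k v. v \<in> D \<Longrightarrow> cmod (shifted a (z k) v - cinner g v) \<le> inverse (real (Suc k)) * form_norm a v"
    by (rule associated_relation_approximation[of g]) blast
  have D: "y k \<in> D" "z k \<in> D" for k using Cy Cz by (simp_all add: form_Cauchy_def)
  have 0: "0 \<in> D" by (rule form_dom_closed(1)[OF angle a])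
  have zero: "hermitian_part (shifted a) 0 v = 0" "energy (shifted a) 0 = 0" if "v \<in> D" for v
    using that 0
    by (simp_all add: hermitian_part_def energy_def form_zero_left[OF angle b] form_zero_right[OF angle b])
  have le: "norm (?R (f + c *\<^sub>C g) - (y k + c *\<^sub>C z k)) \<le> (1 + cmod c) * inverse (real (Suc k))" for k
  proof -
    have "cmod (hermitian_part (shifted a) 0 v - (shifted a (y k + c *\<^sub>C z k) v - cinner (f + c *\<^sub>C g) v)) \<le>
        (1 + cmod c) * inverse (real (Suc k)) * form_norm a v" if v: "v \<in> D" for v
    proof -
      have "hermitian_part (shifted a) 0 v - (shifted a (y k + c *\<^sub>C z k) v - cinner (f + c *\<^sub>C g) v) =
          - (shifted a (y k) v - cinner f v) - c * (shifted a (z k) v - cinner g v)"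
        using D v by (simp add: zero form_add_left[OF angle b] form_scaleC_left[OF angle b]
            form_dom_closed[OF angle a] cinner_add_left cinner_scaleC_left algebra_simps)
      also have "cmod \<dots> \<le> cmod (shifted a (y k) v - cinner f v) + cmod c * cmod (shifted a (z k) v - cinner g v)"
        by (rule order_trans[OF norm_triangle_ineq4]) (simp add: norm_mult norm_minus_commute)
      also have "\<dots> \<le> inverse (real (Suc k)) * form_norm a v + cmod c * (inverse (real (Suc k)) * form_norm a v)"
        by (intro add_mono mult_left_mono y z v) auto
      finally show ?thesis by (simp add: algebra_simps)
    qed
    from resolvent_near[OF _ 0 _ this] show ?thesis
      using D by (simp add: form_dom_closed[OF angle a] zero[OF 0])
  qed
  have "(\<lambda>k. (1 + cmod c) * inverse (real (Suc k))) \<longlonglongrightarrow> 0"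
    using tendsto_mult[OF tendsto_const LIMSEQ_inverse_real_of_nat, of "1 + cmod c"] by simp
  then have "(\<lambda>k. ?R (f + c *\<^sub>C g) - (y k + c *\<^sub>C z k)) \<longlonglongrightarrow> 0"
    by (rule Lim_null_comparison[OF always_eventually[OF allI[OF le]]])
  from tendsto_diff[OF tendsto_const[of "?R (f + c *\<^sub>C g)"] this]
  have "(\<lambda>k. y k + c *\<^sub>C z k) \<longlonglongrightarrow> ?R (f + c *\<^sub>C g)"
    by (simp only: diff_diff_eq2 add_diff_cancel_left' diff_zero)
  moreover have "(\<lambda>k. y k + c *\<^sub>C z k) \<longlonglongrightarrow> ?R f + c *\<^sub>C ?R g"
    by (intro tendsto_add yx tendsto_scaleC zx)
  ultimately show ?thesis by (rule LIMSEQ_unique)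
qed

text \<open>Testing the approximate solutions with themselves exhibits the value as a limit of
  values of \<open>a\<close> on the diagonal.\<close>

lemma resolvent_sector:
  "cinner (f - resolvent (associated_relation D a) f) (resolvent (associated_relation D a) f)
    \<in> closure (sector \<theta>)"
proof -
  obtain y where y: "form_Cauchy D a y" "y \<longlonglongrightarrow> resolvent (associated_relation D a) f"
    "\<And>w z. form_Cauchy D a w \<Longrightarrow> w \<longlonglongrightarrow> z \<Longrightarrow>
      (\<lambda>k. a (y k) (w k)) \<longlonglongrightarrow> cinner (f - resolvent (associated_relation D a) f) z"
    by (rule associated_relation_approximation[of f]) blast
  have "a (y k) (y k) \<in> closure (sector \<theta>)" for k
    using y(1) a by (simp add: form_Cauchy_def sectorial_form_def)
  from closed_sequentially[OF closed_closure this y(3)[OF y(1,2)]] show ?thesis .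
qed

end

section \<open>Convergence of the resolvents and the limit relation\<close>

theorem theorem4p1:
  fixes \<theta> :: real
    and D :: "nat \<Rightarrow> 'h::complex_hilbert_space set"
    and a :: "nat \<Rightarrow> 'h \<Rightarrow> 'h \<Rightarrow> complex"
  assumes "0 \<le> \<theta>" and "\<theta> < pi / 2"
    and "\<And>n. sectorial_form \<theta> (D n) (a n)"
    and "\<And>n. D (Suc n) \<subseteq> D n"
    and "\<And>n. sectorial_form \<theta> (D (Suc n)) (\<lambda>u v. a (Suc n) u v - a n u v)"
  shows "\<exists>A. m_sectorial A \<and>
    strong_resolvent_conv (\<lambda>n. associated_relation (D n) (a n)) A"
proof -
  note angle = assms(1,2) and a = assms(3)
  define b where "b n = shifted (a n)" for n
  have b: "sectorial_form \<theta> (D n) (b n)" for n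
    unfolding b_def by (rule sectorial_form_shifted[OF angle a])
  have incr: "sectorial_form \<theta> (D (Suc n)) (\<lambda>u v. b (Suc n) u v - b n u v)" for n
    using assms(5)[of n] by (simp add: b_def shifted_def)
  have bN: "sqrt (energy (b n) u) = form_norm (a n) u" for n u
    unfolding b_def by (rule sqrt_energy_shifted[OF angle a])
  define K where "K = 2 / cos \<theta>"
  have K: "0 < K" using angle by (simp add: K_def cos_gt_zero_pi)
  define R where "R n = resolvent (associated_relation (D n) (a n))" for n
  have conv: "convergent (\<lambda>n. R n f)" for f
  proof -
    have "\<exists>N. \<forall>n\<ge>N. dist (R n f) (R N f) < e" if e: "0 < e" for e
    proof -
      \<comment> \<open>Two distances from resolvent to iterate cost \<open>2 * d\<close> each and
        the iterates differ by at most \<open>d\<close>, in total \<open>5 * d < e\<close>.\<close>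
      define d where "d = e / 6"
      have d: "0 < d" using e by (simp add: d_def)
      have "solvable_upto D b (cinner f) ((d / K)\<^sup>2)"
        by (rule solvable_upto_any[where D = D and b = b and M = "2 * norm f", OF angle b assms(4) incr])
          (use d K in \<open>auto simp: cinner_add_right cinner_scaleC_right bN
            intro!: cinner_le_form_norm[OF angle a]\<close>)
      then obtain u w \<epsilon> where u: "form_convergent D b u" and w: "\<And>n. w n \<in> D n" and eps: "\<epsilon> \<longlonglongrightarrow> 0"
        and r: "\<And>n v. v \<in> D n \<Longrightarrow>
          cmod (hermitian_part (b n) (w n) v - (b n (u n) v - cinner f v)) \<le> \<epsilon> n * sqrt (energy (b n) v)"
        and s: "\<forall>\<^sub>F n in sequentially. energy (b n) (w n) \<le> (d / K)\<^sup>2"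
        unfolding solvable_upto_def residual_represented_def by blast
      have uD: "u n \<in> D n" for n using u by (simp add: form_convergent_def)
      obtain N1 where N1: "\<And>n. n \<ge> N1 \<Longrightarrow> energy (b n) (w n) \<le> (d / K)\<^sup>2"
        using s by (auto simp: eventually_sequentially)
      obtain N2 where N2: "\<And>n. n \<ge> N2 \<Longrightarrow> \<bar>\<epsilon> n\<bar> < d"
        using eps d unfolding LIMSEQ_iff by auto
      obtain N3 where N3: "\<And>n m. n \<ge> N3 \<Longrightarrow> m \<ge> n \<Longrightarrow> oscillation b u n m \<le> d\<^sup>2"
        using u d unfolding form_convergent_def by (meson zero_less_power)
      define N where "N = max N1 (max N2 N3)"
      have near: "norm (R n f - u n) \<le> 2 * d" if "n \<ge> N" for n
      proof -
        have "norm (R n f - u n) \<le> K * sqrt (energy (b n) (w n)) + d"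
          unfolding R_def K_def b_def
        proof (rule resolvent_near[OF angle a uD w less_imp_le[OF d]])
          fix v assume v: "v \<in> D n"
          have "\<epsilon> n * form_norm (a n) v \<le> d * form_norm (a n) v"
            using N2[of n] that form_norm_nonneg[OF angle a v] by (intro mult_right_mono) (auto simp: N_def)
          then show "cmod (hermitian_part (shifted (a n)) (w n) v - (shifted (a n) (u n) v - cinner f v)) \<le>
              d * form_norm (a n) v"
            using r[OF v] unfolding b_def bN[unfolded b_def] by linarith
        qed
        moreover have "sqrt (energy (b n) (w n)) \<le> d / K"
          using N1[of n] that d K by (intro real_le_lsqrt) (auto simp: N_def)
        then have "K * sqrt (energy (b n) (w n)) \<le> d"
          using K by (simp add: field_simps)
        ultimately show ?thesis by linarith
      qed
      have "dist (R n f) (R N f) < e" if n: "n \<ge> N" for n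
      proof -
        \<comment> \<open>Domains decrease, so the difference can be measured in the form norm of
          the lower level \<open>N\<close>, which dominates the norm and is controlled by the
          oscillation.\<close>
        have "u n \<in> D N" using uD D_antimono[where D = D and b = b, OF angle b assms(4) incr n] by blast
        then have "norm (u n - u N) \<le> sqrt (energy (b N) (u n - u N))"
          unfolding bN by (intro norm_le_form_norm[OF angle a] form_dom_closed[OF angle a] uD)
        also have "\<dots> \<le> d"
          using order_trans[OF oscillation_ge(1)[where D = D and b = b, OF angle b assms(4) incr uD n] N3[OF _ n]] d
          by (intro real_le_lsqrt) (simp_all add: N_def)
        finally have "norm (u n - u N) \<le> d" .
        moreover have "dist (R n f) (R N f) \<le> norm (R n f - u n) + norm (u n - u N) + norm (R N f - u N)"
          using norm_triangle_ineq[of "R n f - u n" "u n - u N"]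
            norm_triangle_ineq4[of "(R n f - u n) + (u n - u N)" "R N f - u N"]
          by (simp add: dist_norm)
        ultimately show ?thesis using near[OF n] near[of N] e by (simp add: d_def)
      qed
      then show ?thesis by blast
    qed
    then show ?thesis
      by (simp add: Cauchy_altdef2 flip: Cauchy_convergent_iff)
  qed
  define S where "S f = lim (\<lambda>n. R n f)" for f
  have S: "(\<lambda>n. R n f) \<longlonglongrightarrow> S f" for f
    using conv[of f] by (simp add: S_def convergent_LIMSEQ_iff)
  have S_lin: "S (f + c *\<^sub>C g) = S f + c *\<^sub>C S g" for f g c
  proof (rule LIMSEQ_unique[OF S])
    show "(\<lambda>n. R n (f + c *\<^sub>C g)) \<longlonglongrightarrow> S f + c *\<^sub>C S g"
      unfolding R_def resolvent_add_scaleC[OF angle a]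
      by (intro tendsto_add tendsto_scaleC S[unfolded R_def])
  qed
  \<comment> \<open>The relation whose resolvent is \<open>S\<close>: adding the components of a
    pair returns \<open>f\<close>, so the range condition is immediate. \<open>S\<close> may have a
    kernel, in which case \<open>A\<close> is multivalued.\<close>
  define A where "A = range (\<lambda>f. (S f, f - S f))"
  have "csubspace A"
  proof (rule complex_vector.subspaceI)
    have S0: "S 0 = 0" using S_lin[of 0 1 0] by simp
    show "0 \<in> A" by (auto simp: A_def zero_prod_def S0 intro!: image_eqI[of _ _ 0])
    show "x + y \<in> A" if xy: "x \<in> A" "y \<in> A" for x y
    proof -
      obtain f g where "x = (S f, f - S f)" "y = (S g, g - S g)"
        using xy by (auto simp: A_def)
      then show ?thesis
        using S_lin[of f 1 g] by (auto simp: A_def intro!: image_eqI[of _ _ "f + g"])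
    qed
    show "c *\<^sub>C x \<in> A" if x: "x \<in> A" for c x
    proof -
      obtain f where "x = (S f, f - S f)" using x by (auto simp: A_def)
      then show ?thesis
        using S_lin[of 0 c f] S0 by (auto simp: A_def scaleC_prod_def
            complex_vector.scale_right_diff_distrib intro!: image_eqI[of _ _ "c *\<^sub>C f"])
    qed
  qed
  moreover have "cinner (f - S f) (S f) \<in> closure (sector \<theta>)" for f
  proof (rule closed_sequentially[OF closed_closure])
    show "cinner (f - R n f) (R n f) \<in> closure (sector \<theta>)" for n
      unfolding R_def by (rule resolvent_sector[OF angle a])
    show "(\<lambda>n. cinner (f - R n f) (R n f)) \<longlonglongrightarrow> cinner (f - S f) (S f)"
      by (intro tendsto_cinner tendsto_intros S)
  qed
  moreover have id: "(S f, f) \<in> id_plus_rel A" for f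
    by (force simp: id_plus_rel_def A_def)
  ultimately have "m_sectorial_angle \<theta> A"
    unfolding m_sectorial_angle_def linear_relation_def by (auto simp: A_def)
  then have A: "m_sectorial A" using angle by (auto simp: m_sectorial_def)
  moreover have "resolvent A f = S f" for f
    using m_sectorial_resolvent[OF A, of f "S f"] id by simp
  then have "strong_resolvent_conv (\<lambda>n. associated_relation (D n) (a n)) A"
    unfolding strong_resolvent_conv_def using S by (simp add: R_def)
  ultimately show ?thesis by blast
qed

end
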